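(* (i) Let $d\geq 4$ be an even integer. Then, for any prime $p\equiv -1\pmod{d}$ with $p\geq 2d-1$, $$ \sum_{k=0}^{p-1}\frac{\left(\frac1d-1\right)_k\left(1+\frac1d\right)_k^{d-1}}{k!^{\,d}}\equiv \frac{d-1}{d^2}\,\Gamma_p\!\left(-\frac1d\right)^d\pmod{p^2}. $$ (ii) Let $d\geq 3$ be an odd integer. Then, for any prime $p\equiv -1\pmod{d}$, $$ \sum_{k=0}^{p-1}\frac{\left(\frac1d\right)_k^2\left(1+\frac1d\right)_k^{d-2}}{k!^{\,d}}\equiv -\frac{1}{d^2}\,\Gamma_p\!\left(-\frac1d\right)^d\pmod{p^2}. $$
   Context: For $n\in\{0,1,2,\ldots\}$, $(x)_n=x(x+1)\cdots(x+n-1)$ denotes the Pochhammer symbol (with $(x)_0=1$). For an odd prime $p$, $\mathbb{Z}_p$ denotes the ring of $p$-adic integers; congruences modulo $p^2$ are congruences in $\mathbb{Z}_p$ (the left-hand sides are rational numbers whose denominators are prime to $p$). The $p$-adic Gamma function of Morita is defined by $\Gamma_p(0)=1$, $\Gamma_p(n)=(-1)^n\prod_{1\leq k<n,\ p\nmid k}k$ for integers $n\geq 1$, and $\Gamma_p(x)=\lim_{n\to x}\Gamma_p(n)$ for $x\in\mathbb{Z}_p$, where $n$ runs through any sequence of positive integers $p$-adically approaching $x$. Since $p\nmid d$, $-1/d\in\mathbb{Z}_p$. *)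

theory Defs
  imports
    Complex_Main
    "HOL-Algebra.Ideal"
    "HOL-Number_Theory.Cong"
    "HOL-Computational_Algebra.Primes"
begin

text \<open>
  The ring of \<open>p\<close>-adic integers as the inverse limit of the rings \<open>\<int>/p\<^sup>n\<int>\<close>: the \<open>n\<close>-th component of
  a \<open>p\<close>-adic integer is its residue modulo \<open>p\<^sup>n\<close>, represented in \<open>{0..<p\<^sup>n}\<close>.
\<close>

definition padic_ints :: "nat \<Rightarrow> (nat \<Rightarrow> int) ring" where
  "padic_ints p =
     \<lparr>carrier = {x. \<forall>n. x n \<in> {0..<int p ^ n} \<and> x (Suc n) mod int p ^ n = x n},
      monoid.mult = (\<lambda>x y n. (x n * y n) mod int p ^ n),
      one = (\<lambda>n. 1 mod int p ^ n),
      zero = (\<lambda>n. 0),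
      add = (\<lambda>x y n. (x n + y n) mod int p ^ n)\<rparr>"

definition padic_of_int :: "nat \<Rightarrow> int \<Rightarrow> nat \<Rightarrow> int" where
  "padic_of_int p a = (\<lambda>n. a mod int p ^ n)"

text \<open>
  The image in \<open>\<int>\<^sub>p\<close> of a rational number whose denominator is prime to \<open>p\<close>; for any other rational
  number no such \<open>x\<close> exists and the value is unspecified.
\<close>

definition padic_of_rat :: "nat \<Rightarrow> rat \<Rightarrow> nat \<Rightarrow> int" where
  "padic_of_rat p q =
     (THE x. x \<in> carrier (padic_ints p) \<and>
        padic_of_int p (snd (quotient_of q)) \<otimes>\<^bsub>padic_ints p\<^esub> x =
          padic_of_int p (fst (quotient_of q)))"

definition padic_cong :: "nat \<Rightarrow> nat \<Rightarrow> (nat \<Rightarrow> int) \<Rightarrow> (nat \<Rightarrow> int) \<Rightarrow> bool" where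
  "padic_cong p N x y \<longleftrightarrow>
     x \<ominus>\<^bsub>padic_ints p\<^esub> y \<in> PIdl\<^bsub>padic_ints p\<^esub> (padic_of_int p (int p ^ N))"

definition padic_tendsto :: "nat \<Rightarrow> (nat \<Rightarrow> nat \<Rightarrow> int) \<Rightarrow> (nat \<Rightarrow> int) \<Rightarrow> bool" where
  "padic_tendsto p s x \<longleftrightarrow> (\<forall>N. \<exists>i0. \<forall>i\<ge>i0. padic_cong p N (s i) x)"

definition padic_Gamma_nat :: "nat \<Rightarrow> nat \<Rightarrow> int" where
  "padic_Gamma_nat p n =
     (if n = 0 then 1 else (- 1) ^ n * (\<Prod>k \<in> {k. 1 \<le> k \<and> k < n \<and> \<not> p dvd k}. int k))"

text \<open>
  Morita's function. For odd primes \<open>p\<close> the limit exists and does not depend on the sequence \<open>s\<close>;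
  on nonnegative integers it agrees with \<open>padic_Gamma_nat\<close>.
\<close>

definition padic_Gamma :: "nat \<Rightarrow> (nat \<Rightarrow> int) \<Rightarrow> nat \<Rightarrow> int" where
  "padic_Gamma p x =
     (THE y. y \<in> carrier (padic_ints p) \<and>
        (\<forall>s. (\<forall>i. 0 < s i) \<and> padic_tendsto p (\<lambda>i. padic_of_int p (int (s i))) x \<longrightarrow>
             padic_tendsto p (\<lambda>i. padic_of_int p (padic_Gamma_nat p (s i))) y))"

lemma padic_of_int_closed:
  assumes "0 < p"
  shows "padic_of_int p a \<in> carrier (padic_ints p)"
  using assms by (auto simp: padic_ints_def padic_of_int_def mod_mod_cancel)

lemma cring_padic_ints:
  assumes p: "0 < p"
  shows "cring (padic_ints p)"
proof (rule cringI)
  let ?R = "padic_ints p"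
  have q: "0 < int p ^ n" for n
    using p by simp
  have down: "z mod int p ^ Suc n mod int p ^ n = z mod int p ^ n" for z :: int and n
    by (rule mod_mod_cancel) simp
  have comp: "x (Suc n) mod int p ^ n = x n" "x n mod int p ^ n = x n" "0 \<le> x n" "x n < int p ^ n"
    if "x \<in> carrier ?R" for x n
    using that by (auto simp: padic_ints_def)
  have closed: "(\<lambda>n. f (x n) (y n) mod int p ^ n) \<in> carrier ?R"
    if x: "x \<in> carrier ?R" and y: "y \<in> carrier ?R"
      and f: "\<And>a b m. f a b mod m = f (a mod m) (b mod m) mod m" for f x y
  proof -
    have "f (x (Suc n)) (y (Suc n)) mod int p ^ n = f (x n) (y n) mod int p ^ n" for n
      using f[of "x (Suc n)" "y (Suc n)" "int p ^ n"] comp(1)[OF x] comp(1)[OF y] by simp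
    then show ?thesis
      using q down by (simp add: padic_ints_def del: power_Suc)
  qed
  have add: "x \<oplus>\<^bsub>?R\<^esub> y = (\<lambda>n. (x n + y n) mod int p ^ n)"
    and mult: "x \<otimes>\<^bsub>?R\<^esub> y = (\<lambda>n. (x n * y n) mod int p ^ n)"
    and zero: "\<zero>\<^bsub>?R\<^esub> = (\<lambda>n. 0)" and one: "\<one>\<^bsub>?R\<^esub> = (\<lambda>n. 1 mod int p ^ n)" for x y
    by (simp_all add: padic_ints_def)
  have addc: "x \<oplus>\<^bsub>?R\<^esub> y \<in> carrier ?R" if "x \<in> carrier ?R" "y \<in> carrier ?R" for x y
    unfolding add using closed[OF that, of "(+)"] by (simp add: mod_simps)
  have multc: "x \<otimes>\<^bsub>?R\<^esub> y \<in> carrier ?R" if "x \<in> carrier ?R" "y \<in> carrier ?R" for x y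
    unfolding mult using closed[OF that, of "(*)"] by (simp add: mod_simps)
  have zeroc: "\<zero>\<^bsub>?R\<^esub> \<in> carrier ?R"
    using p by (simp add: padic_ints_def)
  show "abelian_group ?R"
  proof (rule abelian_groupI)
    fix x assume x: "x \<in> carrier ?R"
    let ?y = "\<lambda>n. (0 - x n) mod int p ^ n"
    have "?y \<in> carrier ?R"
      using closed[OF zeroc x, of "(-)"] unfolding zero by (simp add: mod_simps)
    moreover have "?y \<oplus>\<^bsub>?R\<^esub> x = \<zero>\<^bsub>?R\<^esub>"
      unfolding add zero by (simp add: mod_simps)
    ultimately show "\<exists>y\<in>carrier ?R. y \<oplus>\<^bsub>?R\<^esub> x = \<zero>\<^bsub>?R\<^esub>" by blast
  qed (auto simp: addc zeroc, auto simp: add zero comp mod_simps algebra_simps)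
  show "comm_monoid ?R"
  proof (rule comm_monoidI)
    show "\<one>\<^bsub>?R\<^esub> \<in> carrier ?R"
      using padic_of_int_closed[OF p, of 1] by (simp add: one padic_of_int_def)
  qed (auto simp: multc, auto simp: mult one comp mod_simps algebra_simps)
  show "(x \<oplus>\<^bsub>?R\<^esub> y) \<otimes>\<^bsub>?R\<^esub> z = x \<otimes>\<^bsub>?R\<^esub> z \<oplus>\<^bsub>?R\<^esub> y \<otimes>\<^bsub>?R\<^esub> z" for x y z
    by (auto simp: add mult mod_simps algebra_simps)
qed

end

theory Submission
  imports Defs "HOL-Number_Theory.Residues" "HOL-Computational_Algebra.Polynomial"
begin

text \<open>
  Write \<open>p + 1 = d m\<close>, so that \<open>1/d = m - p/d\<close>. Modulo \<open>p\<^sup>2\<close> a product \<open>\<Prod>\<^sub>i (A + p x\<^sub>i)\<close> depends only on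
  \<open>A\<close> and \<open>\<Sum>\<^sub>i x\<^sub>i\<close>, so the parameters of either sum may be moved by multiples of \<open>p\<close> until one
  numerator parameter is a negative integer \<open>-N\<close> and every other one exceeds a denominator parameter
  by a nonnegative integer, these excesses adding up to \<open>N\<close>. The moved sum is then an \<open>N\<close>-th
  difference of a polynomial of degree \<open>N\<close> (Karlsson--Minton), with value
  \<open>(-1)\<^sup>N N! / \<Prod>\<^sub>i (b\<^sub>i)\<^bsub>M\<^sub>i\<^esub>\<close>.

  On the other side \<open>(p - 1) m \<equiv> -1/d\<close> modulo \<open>p\<^sup>2\<close>, and \<open>\<Gamma>\<^sub>p(p m) \<equiv> (-(p - 1)!)\<^sup>m\<close> gives
  \<open>\<Gamma>\<^sub>p(-1/d)\<^sup>d \<equiv> -(-1)\<^sup>m (p - 1 - m)! / m!\<^bsup>d-1\<^esup>\<close>.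
\<close>

section \<open>Rational numbers modulo powers of \<open>p\<close>\<close>

text \<open>The localisation of the integers at \<open>p\<close>. Any fraction with denominator
  prime to \<open>p\<close> may serve as witness, not only the reduced one, so closure under the
  ring operations needs no cancellation.\<close>

definition p_integral :: "nat \<Rightarrow> rat \<Rightarrow> bool" where
  "p_integral p q \<longleftrightarrow> (\<exists>a b. \<not> int p dvd b \<and> q = of_int a / of_int b)"

definition p_unit :: "nat \<Rightarrow> rat \<Rightarrow> bool" where
  "p_unit p q \<longleftrightarrow> (\<exists>a b. \<not> int p dvd a \<and> \<not> int p dvd b \<and> q = of_int a / of_int b)"

text \<open>Neither side has to be \<open>p\<close>-integral, only the quotient of the difference.
  The product and quotient rules therefore ask for integrality separately.\<close>

definition rat_pcong :: "nat \<Rightarrow> nat \<Rightarrow> rat \<Rightarrow> rat \<Rightarrow> bool" where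
  "rat_pcong p N q r \<longleftrightarrow> (\<exists>e. p_integral p e \<and> q - r = of_nat p ^ N * e)"

context
  fixes p :: nat
  assumes p: "prime p"
begin

lemma p_integral_of_int [simp]: "p_integral p (of_int a)"
  unfolding p_integral_def using p by (intro exI[of _ a] exI[of _ 1]) auto

lemma p_integral_of_nat [simp]: "p_integral p (of_nat a)"
  using p_integral_of_int[of "int a"] by simp

lemma p_integral_fact [simp]: "p_integral p (fact n)"
  using p_integral_of_nat[of "fact n"] by simp

lemma p_integral_neg_1 [simp]: "p_integral p (- 1)" and p_integral_2 [simp]: "p_integral p 2"
  using p_integral_of_int[of "- 1"] p_integral_of_int[of 2] by simp_all

lemma p_integral_0 [simp]: "p_integral p 0" and p_integral_1 [simp]: "p_integral p 1"
  using p_integral_of_int[of 0] p_integral_of_int[of 1] by simp_all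

lemma p_integral_mult [intro!]:
  assumes "p_integral p q" "p_integral p r" shows "p_integral p (q * r)"
proof -
  obtain a b c e where *: "\<not> int p dvd b" "q = of_int a / of_int b"
    "\<not> int p dvd e" "r = of_int c / of_int e"
    using assms unfolding p_integral_def by blast
  then show ?thesis unfolding p_integral_def using p
    by (intro exI[of _ "a * c"] exI[of _ "b * e"]) (simp add: prime_dvd_mult_iff)
qed

lemma p_integral_add [intro!]:
  assumes "p_integral p q" "p_integral p r" shows "p_integral p (q + r)"
proof -
  obtain a b c e where *: "\<not> int p dvd b" "q = of_int a / of_int b"
    "\<not> int p dvd e" "r = of_int c / of_int e"
    using assms unfolding p_integral_def by blast
  moreover from this have "b \<noteq> 0" "e \<noteq> 0" by auto
  ultimately show ?thesis unfolding p_integral_def using p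
    by (intro exI[of _ "a * e + c * b"] exI[of _ "b * e"]) (simp add: prime_dvd_mult_iff field_simps)
qed

lemma p_integral_uminus [intro!]: "p_integral p q \<Longrightarrow> p_integral p (- q)"
  using p_integral_mult[of "-1" q] p_integral_of_int[of "-1"] by simp

lemma p_integral_diff [intro!]: "p_integral p q \<Longrightarrow> p_integral p r \<Longrightarrow> p_integral p (q - r)"
  using p_integral_add[of q "- r"] p_integral_uminus by simp

lemma p_integral_power [intro!]: "p_integral p q \<Longrightarrow> p_integral p (q ^ n)"
  by (induction n) auto

lemma p_integral_prod [intro!]: "(\<And>i. i \<in> I \<Longrightarrow> p_integral p (f i)) \<Longrightarrow> p_integral p (prod f I)"
  by (induction I rule: infinite_finite_induct) auto

lemma p_integral_sum: "(\<And>i. i \<in> I \<Longrightarrow> p_integral p (f i)) \<Longrightarrow> p_integral p (sum f I)"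
  by (induction I rule: infinite_finite_induct) auto

lemma p_unit_imp_p_integral: "p_unit p q \<Longrightarrow> p_integral p q"
  unfolding p_unit_def p_integral_def by blast

lemma p_unit_nonzero: "p_unit p q \<Longrightarrow> q \<noteq> 0"
  unfolding p_unit_def by auto

lemma p_unit_inverse: "p_unit p q \<Longrightarrow> p_unit p (inverse q)"
  unfolding p_unit_def by (metis inverse_divide)

lemma p_integral_divide [intro!]: "p_integral p q \<Longrightarrow> p_unit p r \<Longrightarrow> p_integral p (q / r)"
  unfolding divide_inverse by (simp add: p_integral_mult p_unit_imp_p_integral p_unit_inverse)

lemma p_unit_of_nat: "\<not> p dvd n \<Longrightarrow> p_unit p (of_nat n)"
  unfolding p_unit_def using p by (intro exI[of _ "int n"] exI[of _ 1]) auto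

lemma p_unit_1 [simp]: "p_unit p 1"
  using p_unit_of_nat[of 1] p not_prime_1 by fastforce

lemma p_unit_mult [intro!]:
  assumes "p_unit p q" "p_unit p r" shows "p_unit p (q * r)"
proof -
  obtain a b c e where *: "\<not> int p dvd a" "\<not> int p dvd b" "q = of_int a / of_int b"
    "\<not> int p dvd c" "\<not> int p dvd e" "r = of_int c / of_int e"
    using assms unfolding p_unit_def by blast
  then show ?thesis unfolding p_unit_def using p
    by (intro exI[of _ "a * c"] exI[of _ "b * e"]) (simp add: prime_dvd_mult_iff)
qed

lemma p_unit_power [intro!]: "p_unit p q \<Longrightarrow> p_unit p (q ^ n)"
  by (induction n) auto

lemma p_unit_prod [intro!]: "(\<And>i. i \<in> I \<Longrightarrow> p_unit p (f i)) \<Longrightarrow> p_unit p (prod f I)"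
  by (induction I rule: infinite_finite_induct) auto

text \<open>Over the common denominator \<open>b * e\<close> the numerator is \<open>a * e\<close>
  plus a multiple of \<open>p\<close>, hence prime to \<open>p\<close>.\<close>

lemma p_unit_add_multiple:
  assumes "p_unit p q" "p_integral p r" shows "p_unit p (q + of_nat p * r)"
proof -
  obtain a b c e where *: "\<not> int p dvd a" "\<not> int p dvd b" "q = of_int a / of_int b"
    "\<not> int p dvd e" "r = of_int c / of_int e"
    using assms unfolding p_unit_def p_integral_def by blast
  moreover from this have "b \<noteq> 0" "e \<noteq> 0" by auto
  moreover have "\<not> int p dvd a * e + int p * (c * b)" "\<not> int p dvd b * e"
    using * p by (simp_all add: prime_dvd_mult_iff dvd_add_left_iff)
  moreover from calculation
  have "q + of_nat p * r = of_int (a * e + int p * (c * b)) / of_int (b * e)"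
    unfolding *(3,5) by (simp add: divide_simps)
  ultimately show ?thesis unfolding p_unit_def by blast
qed

section \<open>Congruence calculus in the localisation\<close>

lemma rat_pcong_refl [simp]: "rat_pcong p N q q"
  unfolding rat_pcong_def by (intro exI[of _ 0]) simp

lemma rat_pcong_sym: "rat_pcong p N q r \<Longrightarrow> rat_pcong p N r q"
  unfolding rat_pcong_def by (metis minus_diff_eq mult_minus_right p_integral_uminus)

lemma rat_pcong_add: "rat_pcong p N a b \<Longrightarrow> rat_pcong p N a' b' \<Longrightarrow> rat_pcong p N (a + a') (b + b')"
  unfolding rat_pcong_def by (metis add_diff_add distrib_left p_integral_add)

lemma rat_pcong_trans [trans]: "rat_pcong p N a b \<Longrightarrow> rat_pcong p N b c \<Longrightarrow> rat_pcong p N a c"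
  using rat_pcong_add[of N a b b c] unfolding rat_pcong_def by simp

text \<open>The splitting \<open>(a - b) * a' + b * (a' - b')\<close> explains why integrality is
  asked of just \<open>a'\<close> and \<open>b\<close>.\<close>

lemma rat_pcong_mult:
  assumes "rat_pcong p N a b" "rat_pcong p N a' b'" "p_integral p a'" "p_integral p b"
  shows "rat_pcong p N (a * a') (b * b')"
proof -
  obtain e e' where *: "p_integral p e" "a - b = of_nat p ^ N * e" "p_integral p e'" "a' - b' = of_nat p ^ N * e'"
    using assms unfolding rat_pcong_def by blast
  have "a * a' - b * b' = (a - b) * a' + b * (a' - b')" by (simp add: algebra_simps)
  also have "\<dots> = of_nat p ^ N * (e * a' + b * e')" using * by (simp add: algebra_simps)
  finally show ?thesis unfolding rat_pcong_def
    using * assms by (intro exI[of _ "e * a' + b * e'"]) auto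
qed

lemma rat_pcong_scale:
  assumes "p_integral p c" "rat_pcong p N a b"
  shows "rat_pcong p N (c * a) (c * b)" "rat_pcong p N (a * c) (b * c)"
proof -
  obtain e where e: "p_integral p e" "a - b = of_nat p ^ N * e"
    using assms(2) unfolding rat_pcong_def by blast
  have "c * a - c * b = c * (a - b)" by (simp add: algebra_simps)
  also have "\<dots> = of_nat p ^ N * (c * e)" using e by simp
  finally show "rat_pcong p N (c * a) (c * b)"
    unfolding rat_pcong_def using e assms(1) by (intro exI[of _ "c * e"]) auto
  then show "rat_pcong p N (a * c) (b * c)" by (simp add: mult.commute)
qed

lemma rat_pcong_prod:
  assumes "\<And>i. i \<in> I \<Longrightarrow> rat_pcong p N (f i) (g i) \<and> p_integral p (f i) \<and> p_integral p (g i)"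
  shows "rat_pcong p N (prod f I) (prod g I)"
  using assms by (induction I rule: infinite_finite_induct) (auto intro!: rat_pcong_mult)

lemma rat_pcong_sum:
  assumes "\<And>i. i \<in> I \<Longrightarrow> rat_pcong p N (f i) (g i)"
  shows "rat_pcong p N (sum f I) (sum g I)"
  using assms by (induction I rule: infinite_finite_induct) (auto intro!: rat_pcong_add)

lemma rat_pcong_divide:
  assumes "rat_pcong p N a b" "rat_pcong p N a' b'" "p_unit p a'" "p_unit p b'" "p_integral p b"
  shows "rat_pcong p N (a / a') (b / b')"
proof -
  have nz: "a' \<noteq> 0" "b' \<noteq> 0" using assms p_unit_nonzero by auto
  have "rat_pcong p N (a * b') (b * a')"
    using assms rat_pcong_sym by (intro rat_pcong_mult) (auto intro: p_unit_imp_p_integral)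
  then obtain e where e: "p_integral p e" "a * b' - b * a' = of_nat p ^ N * e"
    unfolding rat_pcong_def by blast
  have "a / a' - b / b' = of_nat p ^ N * (e / (a' * b'))"
    using e(2) nz by (simp add: field_simps)
  moreover have "p_integral p (e / (a' * b'))" using e assms by blast
  ultimately show ?thesis unfolding rat_pcong_def by blast
qed

lemma rat_pcong_of_int: "[a = b] (mod int p ^ N) \<Longrightarrow> rat_pcong p N (of_int a) (of_int b)"
proof -
  assume "[a = b] (mod int p ^ N)"
  then obtain c where "a - b = int p ^ N * c" by (auto simp: cong_iff_dvd_diff)
  then have "(of_int (a - b) :: rat) = of_int (int p ^ N * c)" by simp
  then show ?thesis unfolding rat_pcong_def by (intro exI[of _ "of_int c"]) simp
qed

lemma p_integral_pochhammer [intro!]: "p_integral p a \<Longrightarrow> p_integral p (pochhammer a k)"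
  unfolding pochhammer_prod by auto

text \<open>Each factor is one of the numbers 1, ..., \<open>k\<close> plus a multiple of
  \<open>p\<close>. So denominators stay invertible after their parameters \<open>1\<close> have
  been moved by multiples of \<open>p\<close>.\<close>

lemma p_unit_pochhammer_one:
  assumes "p_integral p x" "k < p"
  shows "p_unit p (pochhammer (1 + of_nat p * x) k)"
proof -
  have "p_unit p (1 + of_nat p * x + of_nat i)" if "i < k" for i
  proof -
    have "\<not> p dvd Suc i" using that assms by (auto dest: dvd_imp_le)
    then have "p_unit p (of_nat (Suc i) + of_nat p * x)"
      by (intro p_unit_add_multiple p_unit_of_nat assms)
    then show ?thesis by (simp add: add_ac)
  qed
  then show ?thesis unfolding pochhammer_prod by auto
qed

lemma rat_pcong_2I: "q - r = of_nat p ^ 2 * e \<Longrightarrow> p_integral p e \<Longrightarrow> rat_pcong p 2 q r"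
  unfolding rat_pcong_def by blast

text \<open>The binomial theorem to first order. With exponent \<open>Suc n\<close> the right side
  can be written without dividing by \<open>A\<close>, which need not be a unit.\<close>

lemma rat_pcong_power_linear:
  assumes "p_integral p A" "p_integral p x"
  shows "rat_pcong p 2 ((A + of_nat p * x) ^ Suc n) (A ^ n * (A + of_nat (Suc n) * (of_nat p * x)))"
proof (induction n)
  case (Suc n)
  have "rat_pcong p 2 ((A + of_nat p * x) ^ Suc n * (A + of_nat p * x))
      (A ^ n * (A + of_nat (Suc n) * (of_nat p * x)) * (A + of_nat p * x))"
    by (rule rat_pcong_mult[OF Suc]) (use assms in auto)
  also have "rat_pcong p 2 \<dots> (A ^ Suc n * (A + of_nat (Suc (Suc n)) * (of_nat p * x)))"
    \<comment> \<open>The witness is the one quadratic term of the product, divided by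
      \<open>p ^ 2\<close>.\<close>
    by (rule rat_pcong_2I[where e = "A ^ n * of_nat (Suc n) * x ^ 2"])
       (use assms in \<open>auto simp: algebra_simps power2_eq_square simp del: of_nat_Suc\<close>,
        simp add: algebra_simps)
  finally show ?case by (simp add: mult_ac)
qed simp

end

section \<open>A terminating Karlsson--Minton sum\<close>

text \<open>Up to sign this is the \<open>N\<close>-th finite difference of \<open>P\<close> at 0,
  which kills degrees below \<open>N\<close> and multiplies the coefficient of degree
  \<open>N\<close> by \<open>N!\<close>.\<close>

lemma alternating_binomial_sum_poly:
  fixes P :: "'a :: {idom, ring_char_0} poly"
  assumes "degree P \<le> N"
  shows "(\<Sum>k\<le>N. (- 1) ^ k * of_nat (N choose k) * poly P (of_nat k)) = (- 1) ^ N * fact N * coeff P N"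
  using assms
proof (induction N arbitrary: P)
  case 0
  then show ?case by (auto elim!: degree_eq_zeroE)
next
  case (Suc N)
  \<comment> \<open>Write \<open>P = a + X * Q\<close>. The constant contributes an alternating sum
    of binomials, which is 0; in the rest the factor \<open>k\<close> is absorbed by the binomial
    and the index shift replaces \<open>Q\<close> by \<open>Q(X + 1)\<close>, called
    \<open>R\<close>, which has the same coefficient at degree \<open>N\<close>.\<close>
  obtain a Q where P: "P = pCons a Q" by (cases P)
  have dQ: "degree Q \<le> N" using Suc.prems P by (cases "Q = 0") auto
  define R where "R = pcompose Q [:1, 1:]"
  have dR: "degree R \<le> N" unfolding R_def using dQ by (simp add: degree_pcompose)
  have cR: "coeff R N = coeff Q N"
  proof (cases "degree Q = N")
    case True
    then show ?thesis
      using lead_coeff_comp[of "[:1, 1:]" Q] by (simp add: R_def degree_pcompose)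
  next
    case False
    then show ?thesis using dQ by (simp add: R_def degree_pcompose coeff_eq_0)
  qed
  have "(\<Sum>k\<le>Suc N. (- 1) ^ k * of_nat (Suc N choose k) * poly P (of_nat k))
      = a * (\<Sum>k\<le>Suc N. (- 1) ^ k * of_nat (Suc N choose k))
      + (\<Sum>k\<le>Suc N. (- 1) ^ k * (of_nat (k * (Suc N choose k))) * poly Q (of_nat k))"
    by (simp add: P sum_distrib_left sum.distrib[symmetric] algebra_simps del: sum.atMost_Suc binomial_Suc_Suc)
  also have "(\<Sum>k\<le>Suc N. (- 1 :: 'a) ^ k * of_nat (Suc N choose k)) = 0"
    using choose_alternating_sum[of "Suc N"] by simp
  also have "(\<Sum>k\<le>Suc N. (- 1) ^ k * (of_nat (k * (Suc N choose k))) * poly Q (of_nat k))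
     = (\<Sum>k\<le>N. (- 1) ^ Suc k * (of_nat (Suc k * (Suc N choose Suc k))) * poly Q (of_nat (Suc k)))"
    by (subst sum.atMost_Suc_shift) simp
  also have "\<dots> = - of_nat (Suc N) * (\<Sum>k\<le>N. (- 1) ^ k * of_nat (N choose k) * poly R (of_nat k))"
    unfolding Suc_times_binomial sum_distrib_left
    by (intro sum.cong refl) (simp add: R_def poly_pcompose algebra_simps)
  also have "\<dots> = - of_nat (Suc N) * ((- 1) ^ N * fact N * coeff R N)"
    using Suc.IH[OF dR] by simp
  finally show ?case by (simp add: P cR algebra_simps)
qed

definition rising_poly :: "'a :: comm_semiring_1 \<Rightarrow> nat \<Rightarrow> 'a poly" where
  "rising_poly b n = (\<Prod>j<n. [:b + of_nat j, 1:])"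

lemma poly_rising_poly: "poly (rising_poly b n) x = pochhammer (b + x) n"
  by (simp add: rising_poly_def poly_prod pochhammer_prod atLeast0LessThan add_ac)

lemma rising_poly_monic:
  fixes b :: "'a :: idom"
  shows "degree (rising_poly b n) = n" "lead_coeff (rising_poly b n) = 1" "rising_poly b n \<noteq> 0"
proof -
  show "lead_coeff (rising_poly b n) = 1" by (simp add: rising_poly_def lead_coeff_prod)
  then show "rising_poly b n \<noteq> 0" by auto
  show "degree (rising_poly b n) = n"
    unfolding rising_poly_def by (subst degree_prod_eq_sum_degree) auto
qed

text \<open>Both sides are \<open>pochhammer b (M + k)\<close>, split after \<open>M\<close> or
  after \<open>k\<close> factors. Thus the quotient of \<open>pochhammer (b + of_nat M) k\<close> by
  \<open>pochhammer b k\<close> is, up to a constant, a polynomial in \<open>k\<close> of degree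
  \<open>M\<close>.\<close>

lemma pochhammer_shift_quotient:
  fixes b :: "'a :: field"
  shows "pochhammer (b + of_nat M) k * pochhammer b M = pochhammer b k * pochhammer (b + of_nat k) M"
  using pochhammer_product'[of b M k] pochhammer_product'[of b k M] by (simp add: add.commute mult.commute)

text \<open>Each summand is a signed binomial times the value at \<open>k\<close> of a monic
  polynomial of degree \<open>N\<close>, over a constant. Two simple parameters and a third of
  multiplicity \<open>e\<close> are the shape that both sums take; the range may run past
  \<open>N\<close>, where the binomials vanish.\<close>

lemma karlsson_minton_three:
  fixes b1 b2 b3 :: "'a :: field_char_0"
  assumes N: "N = M1 + M2 + e * M3" and K: "N \<le> K"
    and nz: "\<And>k. k \<le> K \<Longrightarrow> pochhammer b1 k \<noteq> 0 \<and> pochhammer b2 k \<noteq> 0 \<and> pochhammer b3 k \<noteq> 0"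
    and M: "M1 \<le> K" "M2 \<le> K" "M3 \<le> K"
  shows "(\<Sum>k=0..K. pochhammer (- of_nat N) k * pochhammer (b1 + of_nat M1) k
              * pochhammer (b2 + of_nat M2) k * pochhammer (b3 + of_nat M3) k ^ e
            / (fact k * pochhammer b1 k * pochhammer b2 k * pochhammer b3 k ^ e))
       = (- 1) ^ N * fact N / (pochhammer b1 M1 * pochhammer b2 M2 * pochhammer b3 M3 ^ e)"
proof -
  define P where "P = rising_poly b1 M1 * rising_poly b2 M2 * rising_poly b3 M3 ^ e"
  define C where "C = pochhammer b1 M1 * pochhammer b2 M2 * pochhammer b3 M3 ^ e"
  have C0: "C \<noteq> 0" using nz M by (simp add: C_def)
  have deg: "degree P = N"
    by (simp add: P_def N degree_mult_eq degree_power_eq rising_poly_monic)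
  have lead: "lead_coeff P = 1"
    by (simp only: P_def lead_coeff_mult lead_coeff_power rising_poly_monic(2)) simp
  have summand: "pochhammer (- of_nat N) k * pochhammer (b1 + of_nat M1) k
              * pochhammer (b2 + of_nat M2) k * pochhammer (b3 + of_nat M3) k ^ e
            / (fact k * pochhammer b1 k * pochhammer b2 k * pochhammer b3 k ^ e)
      = (- 1) ^ k * of_nat (N choose k) * poly P (of_nat k) / C" if "k \<le> K" for k
  proof -
    have "pochhammer (b + of_nat M) k / pochhammer b k = pochhammer (b + of_nat k) M / pochhammer b M"
      if "pochhammer b k \<noteq> 0" "pochhammer b M \<noteq> 0" for b :: 'a and M
      using pochhammer_shift_quotient[of b M k] that by (simp add: field_simps)
    then have q: "pochhammer (b1 + of_nat M1) k / pochhammer b1 k = pochhammer (b1 + of_nat k) M1 / pochhammer b1 M1"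
      "pochhammer (b2 + of_nat M2) k / pochhammer b2 k = pochhammer (b2 + of_nat k) M2 / pochhammer b2 M2"
      "pochhammer (b3 + of_nat M3) k / pochhammer b3 k = pochhammer (b3 + of_nat k) M3 / pochhammer b3 M3"
      using nz M that by blast+
    have s: "pochhammer (- of_nat N) k / fact k = ((- 1) ^ k * of_nat (N choose k) :: 'a)"
    proof -
      have "(- 1) ^ k * of_nat (N choose k)
          = ((- 1) ^ k * (- 1) ^ k) * (pochhammer (- of_nat N) k / fact k :: 'a)"
        by (simp only: binomial_gbinomial gbinomial_pochhammer mult.assoc times_divide_eq_right)
      then show ?thesis by simp
    qed
    have "pochhammer (- of_nat N) k * pochhammer (b1 + of_nat M1) k
              * pochhammer (b2 + of_nat M2) k * pochhammer (b3 + of_nat M3) k ^ e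
            / (fact k * pochhammer b1 k * pochhammer b2 k * pochhammer b3 k ^ e)
      = (pochhammer (- of_nat N) k / fact k) * (pochhammer (b1 + of_nat M1) k / pochhammer b1 k)
        * (pochhammer (b2 + of_nat M2) k / pochhammer b2 k)
        * (pochhammer (b3 + of_nat M3) k / pochhammer b3 k) ^ e"
      by (simp add: power_divide)
    also have "\<dots> = (- 1) ^ k * of_nat (N choose k) * poly P (of_nat k) / C"
      unfolding q s by (simp add: P_def C_def poly_rising_poly power_divide)
    finally show ?thesis .
  qed
  have "(\<Sum>k=0..K. pochhammer (- of_nat N) k * pochhammer (b1 + of_nat M1) k
              * pochhammer (b2 + of_nat M2) k * pochhammer (b3 + of_nat M3) k ^ e
            / (fact k * pochhammer b1 k * pochhammer b2 k * pochhammer b3 k ^ e))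
     = (\<Sum>k=0..K. (- 1) ^ k * of_nat (N choose k) * poly P (of_nat k) / C)"
    by (intro sum.cong refl summand) auto
  also have "\<dots> = (\<Sum>k\<le>N. (- 1) ^ k * of_nat (N choose k) * poly P (of_nat k) / C)"
    using K by (intro sum.mono_neutral_right) (auto simp: binomial_eq_0)
  also have "\<dots> = (\<Sum>k\<le>N. (- 1) ^ k * of_nat (N choose k) * poly P (of_nat k)) / C"
    by (simp add: sum_divide_distrib)
  also have "\<dots> = (- 1) ^ N * fact N / C"
    using alternating_binomial_sum_poly[of P N] deg lead by simp
  finally show ?thesis unfolding C_def .
qed

section \<open>Morita's function on natural numbers\<close>

lemma coprime_prime_power: "prime p \<Longrightarrow> \<not> int p dvd a \<Longrightarrow> coprime a (int p ^ N)"
  using prime_imp_coprime[of "int p" a] by (simp add: coprime_commute)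

text \<open>In \<open>a ^ p - b ^ p = (a - b) * S\<close> the cofactor \<open>S\<close> is congruent
  to \<open>p * b ^ (p - 1)\<close>, hence to 0, modulo \<open>p\<close>, and so supplies one more
  factor \<open>p\<close>.\<close>

lemma cong_power_prime_lift:
  fixes a b :: int
  assumes "[a = b] (mod int p ^ N)" "N > 0"
  shows "[a ^ p = b ^ p] (mod int p ^ Suc N)"
proof -
  have "[a = b] (mod int p)"
    using assms by (meson cong_dvd_modulus dvd_power)
  then have "[(\<Sum>i<p. b ^ (p - Suc i) * a ^ i) = (\<Sum>i<p. b ^ (p - Suc i) * b ^ i)] (mod int p)"
    by (intro cong_sum cong_scalar_left cong_pow)
  also have "(\<Sum>i<p. b ^ (p - Suc i) * b ^ i) = (\<Sum>i<p. b ^ (p - 1))"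
    by (intro sum.cong refl) (simp flip: power_add)
  also have "[\<dots> = 0] (mod int p)" by (simp add: cong_0_iff)
  finally have "int p dvd (\<Sum>i<p. b ^ (p - Suc i) * a ^ i)" by (simp add: cong_0_iff)
  moreover have "int p ^ N dvd a - b" using assms by (simp add: cong_iff_dvd_diff)
  ultimately have "int p ^ N * int p dvd (a - b) * (\<Sum>i<p. b ^ (p - Suc i) * a ^ i)"
    by (intro mult_dvd_mono)
  then show ?thesis by (simp add: cong_iff_dvd_diff power_diff_sumr2 mult_ac)
qed

text \<open>Expansion to first order in \<open>q\<close>. The extra factor \<open>a\<close> on the
  left avoids the exponent \<open>r - 1\<close> on the right.\<close>

lemma cong_prod_arith_progression:
  fixes a q :: int
  shows "[a * (\<Prod>i<r. a + int i * q) = a ^ r * (a + q * (\<Sum>i<r. int i))] (mod q ^ 2)"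
proof (induction r)
  case (Suc r)
  let ?s = "\<Sum>i<r. int i"
  have "[a * (\<Prod>i<Suc r. a + int i * q) = a ^ r * (a + q * ?s) * (a + int r * q)] (mod q ^ 2)"
    using cong_scalar_right[OF Suc, of "a + int r * q"] by (simp add: mult_ac)
  also have "a ^ r * (a + q * ?s) * (a + int r * q)
      = a ^ Suc r * (a + q * (\<Sum>i<Suc r. int i)) + q ^ 2 * (a ^ r * ?s * int r)"
    by (simp add: algebra_simps power2_eq_square)
  also have "[\<dots> = a ^ Suc r * (a + q * (\<Sum>i<Suc r. int i))] (mod q ^ 2)"
    by (simp add: cong_iff_dvd_diff)
  finally show ?case .
qed simp

text \<open>Integer counterpart of \<open>rat_pcong_power_linear\<close>.\<close>

lemma cong_power_linear:
  fixes a x q :: int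
  assumes "q dvd x"
  shows "[(a + x) ^ Suc n = a ^ n * (a + int (Suc n) * x)] (mod q ^ 2)"
proof (induction n)
  case (Suc n)
  obtain y where x: "x = q * y" using assms by blast
  have "[(a + x) ^ Suc (Suc n) = a ^ n * (a + int (Suc n) * x) * (a + x)] (mod q ^ 2)"
    using cong_scalar_right[OF Suc, of "a + x"] by (simp add: mult_ac)
  also have "a ^ n * (a + int (Suc n) * x) * (a + x)
      = a ^ Suc n * (a + int (Suc (Suc n)) * x) + q ^ 2 * (a ^ n * int (Suc n) * y ^ 2)"
    by (simp add: x algebra_simps power2_eq_square)
  also have "[\<dots> = a ^ Suc n * (a + int (Suc (Suc n)) * x)] (mod q ^ 2)"
    by (simp add: cong_iff_dvd_diff)
  finally show ?case .
qed simp

text \<open>Since \<open>p\<close> divides \<open>0\<close>, the value at \<open>0\<close> is \<open>1\<close>; this absorbs the special case \<open>n = 0\<close> of \<open>padic_Gamma_nat\<close>.\<close>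

definition p_free_factor :: "nat \<Rightarrow> nat \<Rightarrow> int" where
  "p_free_factor p k = (if p dvd k then 1 else int k)"

lemma padic_Gamma_nat_eq: "padic_Gamma_nat p n = (- 1) ^ n * (\<Prod>k<n. p_free_factor p k)"
proof -
  have "(\<Prod>k \<in> {k. 1 \<le> k \<and> k < n \<and> \<not> p dvd k}. int k) = (\<Prod>k<n. p_free_factor p k)"
    by (rule prod.mono_neutral_cong_left) (auto simp: p_free_factor_def Suc_le_eq intro: Nat.gr0I)
  then show ?thesis by (simp add: padic_Gamma_nat_def)
qed

lemma padic_Gamma_nat_Suc: "padic_Gamma_nat p (Suc n) = - p_free_factor p n * padic_Gamma_nat p n"
  by (simp add: padic_Gamma_nat_eq)

lemma padic_Gamma_nat_add:
  assumes "\<And>t. t < i \<Longrightarrow> \<not> p dvd n + t"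
  shows "padic_Gamma_nat p (n + i) = padic_Gamma_nat p n * (\<Prod>t<i. - int (n + t))"
  using assms by (induction i) (auto simp: padic_Gamma_nat_Suc p_free_factor_def)

lemma prod_p_free_factor_fact: "n < p \<Longrightarrow> (\<Prod>k<Suc n. p_free_factor p k) = fact n"
proof (induction n)
  case (Suc n)
  have "\<not> p dvd Suc n" using Suc.prems by (auto dest: dvd_imp_le)
  then show ?case using Suc by (simp add: p_free_factor_def mult_ac)
qed (simp add: p_free_factor_def)

lemma fact_eq_falling_prod: "m \<le> n \<Longrightarrow> (fact n :: int) = (\<Prod>j<m. int (n - j)) * fact (n - m)"
proof (induction m)
  case (Suc m)
  have "fact (n - m) = int (n - m) * fact (n - Suc m)"
    using Suc.prems fact_reduce[of "n - m", where ?'a = int] by simp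
  then show ?case using Suc by simp
qed simp

section \<open>Morita's function at odd primes: periodicity and values modulo
  \<open>p ^ 2\<close>\<close>

context
  fixes p :: nat
  assumes p: "prime p" and odd_p: "odd p"
begin

lemma odd_prime_gt_0: "p > 0" and odd_prime_gt_2: "p > 2"
  using p odd_p prime_gt_1_nat[OF p] by (auto simp: prime_gt_0_nat) (cases "p = 2"; simp)

lemma not_dvd_fact: "n < p \<Longrightarrow> \<not> int p dvd fact n"
  using prime_dvd_fact_iff[OF p, of n] int_dvd_int_iff[of p "fact n"] by simp

text \<open>Wilson's theorem for powers of an odd prime. Grouping the numbers below
  \<open>p ^ Suc N\<close> by their residue \<open>k\<close> modulo \<open>p ^ N\<close>, each class
  has product \<open>k ^ p\<close> for \<open>k\<close> prime to \<open>p\<close>, so the whole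
  product is the \<open>p\<close>-th power of the previous one, and taking \<open>p\<close>-th
  powers lifts the congruence.\<close>

lemma prod_p_free_factor_prime_power:
  "N > 0 \<Longrightarrow> [(\<Prod>k<p ^ N. p_free_factor p k) = - 1] (mod int p ^ N)"
proof (induction N)
  case (Suc N)
  show ?case
  proof (cases "N = 0")
    case True
    have "(\<Prod>k<p. p_free_factor p k) = fact (p - 1)"
      using prod_p_free_factor_fact[of "p - 1" p] odd_prime_gt_0 by simp
    then show ?thesis using wilson_theorem[OF p] True by simp
  next
    case False
    let ?q = "p ^ N"
    obtain h where h: "p = 2 * h + 1" using odd_p by (auto elim: oddE)
    \<comment> \<open>Oddness of \<open>p\<close> makes the sum of \<open>i < p\<close> divisible by
      \<open>p\<close>; this removes the linear term of the expansion.\<close>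
    have "(\<Sum>i<2 * h + 1. int i) = int (2 * h + 1) * int h"
      by (induction h) (auto simp: algebra_simps)
    then have psum: "(\<Sum>i<p. int i) = int p * int h" using h by simp
    have step: "[(\<Prod>i<p. p_free_factor p (i * ?q + k)) = p_free_factor p k ^ p] (mod int p ^ Suc N)" for k
    proof (cases "p dvd k")
      case True
      then show ?thesis using False by (simp add: p_free_factor_def)
    next
      case nd: False
      have "p dvd i * ?q" for i using False by simp
      then have eq: "(\<Prod>i<p. p_free_factor p (i * ?q + k)) = (\<Prod>i<p. int k + int i * int ?q)"
        using nd by (intro prod.cong) (auto simp: p_free_factor_def dvd_add_right_iff)
      \<comment> \<open>Since \<open>N\<close> is at least 1, \<open>Suc N\<close> is at most
        \<open>2 * N\<close>.\<close>
      have "int p ^ Suc N dvd int ?q ^ 2"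
        using False by (simp flip: power_mult add: le_imp_power_dvd del: power_Suc)
      from cong_dvd_modulus[OF cong_prod_arith_progression this]
      have "[int k * (\<Prod>i<p. int k + int i * int ?q) = int k ^ p * (int k + int ?q * (\<Sum>i<p. int i))]
          (mod int p ^ Suc N)" .
      also have "int k ^ p * (int k + int ?q * (\<Sum>i<p. int i))
           = int k * int k ^ p + int p ^ Suc N * (int k ^ p * int h)"
        by (simp add: psum algebra_simps)
      also have "[\<dots> = int k * int k ^ p] (mod int p ^ Suc N)"
        by (simp add: cong_iff_dvd_diff)
      finally have "[(\<Prod>i<p. int k + int i * int ?q) = int k ^ p] (mod int p ^ Suc N)"
        using cong_mult_lcancel[OF coprime_prime_power[OF p]] nd by (metis int_dvd_int_iff)
      then show ?thesis unfolding eq using nd by (simp add: p_free_factor_def)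
    qed
    have "(\<Prod>k<p ^ Suc N. p_free_factor p k) = (\<Prod>i<p. \<Prod>k=i * ?q..<i * ?q + ?q. p_free_factor p k)"
      by (subst prod.nat_group) simp
    also have "\<dots> = (\<Prod>i<p. \<Prod>k<?q. p_free_factor p (i * ?q + k))"
    proof (rule prod.cong[OF refl])
      fix i
      show "(\<Prod>k=i * ?q..<i * ?q + ?q. p_free_factor p k) = (\<Prod>k<?q. p_free_factor p (i * ?q + k))"
        by (rule prod.reindex_bij_witness[of _ "\<lambda>k. i * ?q + k" "\<lambda>k. k - i * ?q"]) auto
    qed
    also have "\<dots> = (\<Prod>k<?q. \<Prod>i<p. p_free_factor p (i * ?q + k))"
      by (rule prod.swap)
    also have "[\<dots> = (\<Prod>k<?q. p_free_factor p k ^ p)] (mod int p ^ Suc N)"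
      by (intro cong_prod step)
    also have "(\<Prod>k<?q. p_free_factor p k ^ p) = (\<Prod>k<?q. p_free_factor p k) ^ p"
      by (simp add: prod_power_distrib)
    also have "[\<dots> = (- 1) ^ p] (mod int p ^ Suc N)"
      using False by (intro cong_power_prime_lift Suc.IH) auto
    finally show ?thesis using odd_p by simp
  qed
qed simp

text \<open>At argument 0 the sign \<open>(- 1) ^ (p ^ N)\<close> cancels the \<open>- 1\<close> of
  Wilson's theorem; from there the recurrence has congruent factors at \<open>n\<close> and
  \<open>n + p ^ N\<close>.\<close>

lemma padic_Gamma_nat_add_prime_power:
  assumes "n > 0"
  shows "[padic_Gamma_nat p (n + p ^ N) = padic_Gamma_nat p n] (mod int p ^ N)"
proof (cases "N = 0")
  case False
  have "[padic_Gamma_nat p (n + p ^ N) = padic_Gamma_nat p n] (mod int p ^ N)" for n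
  proof (induction n)
    case 0
    show ?case
      using cong_mult[OF cong_refl[of "- 1"] prod_p_free_factor_prime_power[of N]] False odd_p
      by (simp add: padic_Gamma_nat_eq)
  next
    case (Suc n)
    have d: "p dvd p ^ N" using False by simp
    then have "[p_free_factor p (n + p ^ N) = p_free_factor p n] (mod int p ^ N)"
      by (auto simp: p_free_factor_def cong_iff_dvd_diff dvd_add_left_iff)
    from cong_mult[OF this Suc] show ?case
      by (simp add: padic_Gamma_nat_Suc cong_minus_minus_iff)
  qed
  then show ?thesis .
qed simp

text \<open>Uniform \<open>p\<close>-adic continuity on the positive integers, the source of the
  limit defining Morita's function. The congruence is expressed by adding multiples of
  \<open>p ^ N\<close> on both sides, so no subtraction of naturals occurs.\<close>

lemma padic_Gamma_nat_cong:
  assumes "0 < a" "0 < b" "[int a = int b] (mod int p ^ N)"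
  shows "[padic_Gamma_nat p a = padic_Gamma_nat p b] (mod int p ^ N)"
proof -
  have *: "[padic_Gamma_nat p (n + j * p ^ N) = padic_Gamma_nat p n] (mod int p ^ N)" if "0 < n" for n j
  proof (induction j)
    case (Suc j)
    have "[padic_Gamma_nat p (n + j * p ^ N + p ^ N) = padic_Gamma_nat p (n + j * p ^ N)] (mod int p ^ N)"
      using that by (intro padic_Gamma_nat_add_prime_power) simp
    from cong_trans[OF this Suc] show ?case by (simp add: add_ac)
  qed simp
  have "[a = b] (mod p ^ N)"
    using assms by (simp flip: cong_int_iff)
  then obtain i j where "a + i * p ^ N = b + j * p ^ N"
    by (metis cong_iff_lin_nat)
  then show ?thesis using *[OF assms(1), of i] *[OF assms(2), of j] by (metis cong_sym cong_trans)
qed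

text \<open>Pairing \<open>j\<close> with \<open>p - j\<close> gives \<open>(i * p + j) * (i * p + p
  - j) = j * (p - j) + p ^ 2 * i * (i + 1)\<close>, so the square of the block does not depend on
  \<open>i\<close> modulo \<open>p ^ 2\<close>. The sign of the root is settled modulo
  \<open>p\<close>.\<close>

lemma cong_prod_shifted_block:
  "[(\<Prod>j\<in>{1..<p}. int (i * p) + int j) = fact (p - 1)] (mod int p ^ 2)"
proof -
  let ?X = "\<lambda>i. \<Prod>j\<in>{1..<p}. int (i * p) + int j"
  have rev: "?X i = (\<Prod>j\<in>{1..<p}. int (i * p) + int (p - j))" for i
    by (rule prod.reindex_bij_witness[of _ "\<lambda>j. p - j" "\<lambda>j. p - j"]) auto
  have sq: "[?X i ^ 2 = (\<Prod>j\<in>{1..<p}. int j * int (p - j))] (mod int p ^ 2)" for i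
  proof -
    have "?X i ^ 2 = ?X i * (\<Prod>j\<in>{1..<p}. int (i * p) + int (p - j))"
      unfolding power2_eq_square by (subst (2) rev) simp
    also have "\<dots> = (\<Prod>j\<in>{1..<p}. (int (i * p) + int j) * (int (i * p) + int (p - j)))"
      by (simp add: prod.distrib)
    also have "[\<dots> = (\<Prod>j\<in>{1..<p}. int j * int (p - j))] (mod int p ^ 2)"
    proof (rule cong_prod)
      fix j assume "j \<in> {1..<p}"
      then have "(int (i * p) + int j) * (int (i * p) + int (p - j))
          = int j * int (p - j) + int p ^ 2 * (int i * (int i + 1))"
        by (simp add: of_nat_diff algebra_simps power2_eq_square)
      then show "[(int (i * p) + int j) * (int (i * p) + int (p - j)) = int j * int (p - j)] (mod int p ^ 2)"
        by (simp add: cong_iff_dvd_diff)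
    qed
    finally show ?thesis .
  qed
  have X0: "?X 0 = fact (p - 1)"
  proof -
    have "{1..<p} = {1..p - 1}" using odd_prime_gt_0 by auto
    then show ?thesis by (simp add: fact_prod)
  qed
  have "[?X i ^ 2 = ?X 0 ^ 2] (mod int p ^ 2)"
    by (rule cong_trans[OF sq[of i] cong_sym[OF sq[of 0]]])
  then have "int p ^ 2 dvd (?X i + fact (p - 1)) * (?X i - fact (p - 1))"
    unfolding X0 cong_iff_dvd_diff by (simp only: power2_eq_square square_diff_square_factored)
  \<comment> \<open>Otherwise \<open>p\<close> would divide \<open>2 * fact (p - 1)\<close>; hence
    both factors \<open>p\<close> of the modulus divide the difference.\<close>
  moreover have "\<not> int p dvd ?X i + fact (p - 1)"
  proof
    assume dvd: "int p dvd ?X i + fact (p - 1)"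
    have "[?X i = ?X 0] (mod int p)"
      by (intro cong_prod) (simp add: cong_iff_dvd_diff)
    then have "int p dvd ?X i - fact (p - 1)" unfolding X0 by (simp add: cong_iff_dvd_diff)
    from dvd_diff[OF dvd this] have "int p dvd 2 * fact (p - 1)" by simp
    then have "int p dvd 2 \<or> int p dvd fact (p - 1)"
      using p by (simp add: prime_dvd_mult_iff)
    then show False using not_dvd_fact[of "p - 1"] odd_prime_gt_2 zdvd_imp_le[of "int p" 2] by auto
  qed
  ultimately have "int p ^ 2 dvd ?X i - fact (p - 1)"
    using coprime_dvd_mult_right_iff[of "int p ^ 2"] coprime_prime_power[OF p] coprime_commute by blast
  then show ?thesis by (simp add: cong_iff_dvd_diff)
qed

text \<open>The factors below \<open>e * p\<close> form \<open>e\<close> blocks, each congruent to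
  \<open>fact (p - 1)\<close>, and the sign is \<open>(- 1) ^ e\<close> because \<open>p\<close> is
  odd.\<close>

lemma padic_Gamma_nat_prime_multiple:
  "[padic_Gamma_nat p (e * p) = (- fact (p - 1)) ^ e] (mod int p ^ 2)"
proof -
  have block: "(\<Prod>k=i * p..<i * p + p. p_free_factor p k) = (\<Prod>j\<in>{1..<p}. int (i * p) + int j)" for i
  proof -
    have "(\<Prod>k=i * p..<i * p + p. p_free_factor p k) = (\<Prod>j\<in>{0..<p}. p_free_factor p (i * p + j))"
      by (rule prod.reindex_bij_witness[of _ "\<lambda>k. i * p + k" "\<lambda>k. k - i * p"]) auto
    also have "\<dots> = (\<Prod>j\<in>{1..<p}. int (i * p) + int j)"
      by (rule prod.mono_neutral_cong_right)
         (auto simp: p_free_factor_def dvd_add_right_iff Suc_le_eq dest: dvd_imp_le)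
    finally show ?thesis .
  qed
  have "(\<Prod>k<e * p. p_free_factor p k) = (\<Prod>i<e. \<Prod>j\<in>{1..<p}. int (i * p) + int j)"
    by (simp add: block flip: prod.nat_group)
  also have "[\<dots> = (\<Prod>i<e. fact (p - 1))] (mod int p ^ 2)"
    by (intro cong_prod cong_prod_shifted_block)
  finally have "[padic_Gamma_nat p (e * p) = (- 1) ^ (e * p) * fact (p - 1) ^ e] (mod int p ^ 2)"
    unfolding padic_Gamma_nat_eq by (intro cong_scalar_left) simp
  moreover have "(- 1 :: int) ^ (e * p) = (- 1) ^ e"
    using odd_p by (simp add: power_mult mult.commute[of e])
  moreover have "(- fact (p - 1) :: int) ^ e = (- 1) ^ e * fact (p - 1) ^ e"
    by (rule power_minus)
  ultimately show ?thesis by simp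
qed

text \<open>Morita's function at \<open>(p - 1) * m\<close> and at \<open>m * p\<close> differ by
  \<open>m\<close> factors, and the latter value is known modulo \<open>p ^ 2\<close>. Denominators
  are cleared so that the statement stays in the integers.\<close>

lemma padic_Gamma_nat_power_cong:
  assumes dm: "d * m = p + 1" and d: "d > 1"
  shows "[padic_Gamma_nat p ((p - 1) * m) ^ d * fact m ^ (d - 1) * (- 1) ^ m = - fact (p - 1 - m)]
           (mod int p ^ 2)"
proof -
  let ?G = "padic_Gamma_nat p ((p - 1) * m)"
  have mp: "m < p" "m > 0"
  proof -
    show "m > 0" using dm by (intro Nat.gr0I) simp
    have "2 * m \<le> p + 1" using mult_le_mono1[of 2 d m] dm d by simp
    then show "m < p" using odd_prime_gt_2 by simp
  qed
  have pm: "(p - 1) * m + m = m * p" using odd_prime_gt_0 by (cases p) (auto simp: algebra_simps)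
  \<comment> \<open>\<open>w\<close> is the value at \<open>p\<close> modulo \<open>p ^ 2\<close>;
    \<open>Q\<close> collects the top \<open>m\<close> factors of
    \<open>fact (p - 1)\<close>.\<close>
  define w :: int where "w = - fact (p - 1)"
  define Q where "Q = (\<Prod>j<m. int (p - 1 - j))"
  have "[w = 1] (mod int p ^ 1)"
    using wilson_theorem[OF p] cong_minus_minus_iff[of "fact (p - 1) :: int" "- 1"] by (simp add: w_def)
  then have wp: "[w ^ p = 1] (mod int p ^ 2)"
    using cong_power_prime_lift[of w 1 p 1] by (simp add: numeral_2_eq_2)
  have nd: "\<not> p dvd (p - 1) * m + t" if "t < m" for t
  proof
    assume "p dvd (p - 1) * m + t"
    moreover have "(p - 1) * m + t + (m - t) = m * p" using pm that by simp
    ultimately have "p dvd m - t" by (metis dvd_add_right_iff dvd_triv_right)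
    then show False using that mp by (auto dest: dvd_imp_le)
  qed
  have "padic_Gamma_nat p (m * p) = ?G * (\<Prod>t<m. - int ((p - 1) * m + t))"
    unfolding pm[symmetric] using nd by (rule padic_Gamma_nat_add)
  \<comment> \<open>Reversal lets the factors count down from \<open>m * p\<close>: each becomes
    \<open>Suc j - p * m\<close>.\<close>
  also have "(\<Prod>t<m. - int ((p - 1) * m + t)) = (\<Prod>j<m. - int ((p - 1) * m + (m - Suc j)))"
    by (rule prod.nat_diff_reindex[symmetric])
  also have "\<dots> = (\<Prod>j<m. int (Suc j) + (- int p * int m))"
  proof (rule prod.cong)
    fix j assume j: "j \<in> {..<m}"
    have "(p - 1) * m + (m - Suc j) + Suc j = m * p" using pm j by simp
    then have "int ((p - 1) * m + (m - Suc j)) + int (Suc j) = int m * int p"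
      by (metis of_nat_add of_nat_mult)
    then show "- int ((p - 1) * m + (m - Suc j)) = int (Suc j) + (- int p * int m)"
      by (simp add: algebra_simps)
  qed simp
  finally have "?G ^ d * (\<Prod>j<m. (int (Suc j) + (- int p * int m)) ^ d) = padic_Gamma_nat p (m * p) ^ d"
    by (simp add: power_mult_distrib prod_power_distrib)
  also have "[\<dots> = (w ^ m) ^ d] (mod int p ^ 2)"
    unfolding w_def by (intro cong_pow padic_Gamma_nat_prime_multiple)
  \<comment> \<open>The exponent is \<open>d * m = p + 1\<close>, and \<open>w ^ p\<close> is
    congruent to 1 by Wilson's theorem and lifting.\<close>
  also have "(w ^ m) ^ d = w ^ p * w"
    using dm by (simp flip: power_mult add: mult.commute[of m])
  also have "[\<dots> = 1 * w] (mod int p ^ 2)" by (intro cong_mult wp cong_refl)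
  finally have 1: "[?G ^ d * (\<Prod>j<m. (int (Suc j) + (- int p * int m)) ^ d) = w] (mod int p ^ 2)" by simp
  \<comment> \<open>To first order the shift by \<open>- p * m\<close> is multiplied by
    \<open>d\<close>, giving \<open>- p * (p + 1)\<close>, that is \<open>- p\<close> modulo
    \<open>p ^ 2\<close>. The shifted factors \<open>Suc j - p\<close> then assemble to
    \<open>Q\<close> up to sign.\<close>
  have "[(\<Prod>j<m. (int (Suc j) + (- int p * int m)) ^ d)
        = (\<Prod>j<m. int (Suc j) ^ (d - 1) * (int (Suc j) - int p))] (mod int p ^ 2)"
  proof (rule cong_prod)
    fix j
    let ?a = "int (Suc j)"
    have "[(?a + (- int p * int m)) ^ Suc (d - 1)
        = ?a ^ (d - 1) * (?a + int (Suc (d - 1)) * (- int p * int m))] (mod int p ^ 2)"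
      by (rule cong_power_linear) simp
    also have "int (Suc (d - 1)) * (- int p * int m) = - int p * int (d * m)"
      using d by simp
    also have "?a ^ (d - 1) * (?a + - int p * int (d * m))
      = ?a ^ (d - 1) * (?a - int p) + int p ^ 2 * (- (?a ^ (d - 1)))"
      unfolding dm by (simp add: algebra_simps power2_eq_square)
    also have "[\<dots> = ?a ^ (d - 1) * (?a - int p)] (mod int p ^ 2)"
      by (simp add: cong_iff_dvd_diff)
    finally show "[(?a + (- int p * int m)) ^ d = ?a ^ (d - 1) * (?a - int p)] (mod int p ^ 2)"
      using d by simp
  qed
  also have "(\<Prod>j<m. int (Suc j) ^ (d - 1) * (int (Suc j) - int p)) = fact m ^ (d - 1) * ((- 1) ^ m * Q)"
  proof -
    have "(\<Prod>j<m. int (Suc j) - int p) = (\<Prod>j<m. - 1 * int (p - 1 - j))"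
      using mp by (intro prod.cong) (auto simp: of_nat_diff)
    also have "\<dots> = (- 1) ^ m * Q" unfolding prod.distrib by (simp add: Q_def)
    finally have a: "(\<Prod>j<m. int (Suc j) - int p) = (- 1) ^ m * Q" .
    have b: "(\<Prod>j<m. int (Suc j)) = fact m"
      by (simp add: fact_prod_Suc atLeast0LessThan)
    show ?thesis
      unfolding prod.distrib a prod_power_distrib[symmetric] b ..
  qed
  finally have "[?G ^ d * (\<Prod>j<m. (int (Suc j) + (- int p * int m)) ^ d)
      = ?G ^ d * (fact m ^ (d - 1) * ((- 1) ^ m * Q))] (mod int p ^ 2)"
    by (intro cong_scalar_left)
  from cong_trans[OF cong_sym[OF this] 1]
  have "[?G ^ d * (fact m ^ (d - 1) * ((- 1) ^ m * Q)) = w] (mod int p ^ 2)" .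
  moreover have f: "fact (p - 1) = Q * fact (p - 1 - m)"
    unfolding Q_def using mp by (intro fact_eq_falling_prod) auto
  ultimately have "[Q * (?G ^ d * fact m ^ (d - 1) * (- 1) ^ m) = Q * (- fact (p - 1 - m))] (mod int p ^ 2)"
    by (simp add: w_def mult_ac)
  moreover have "\<not> int p dvd Q"
    using not_dvd_fact[of "p - 1"] odd_prime_gt_0 unfolding f by auto
  ultimately show ?thesis
    using cong_mult_lcancel[OF coprime_prime_power[OF p]] by blast
qed

end

section \<open>Evaluation in the inverse limit\<close>

lemma padic_mult_nth: "(x \<otimes>\<^bsub>padic_ints p\<^esub> y) n = x n * y n mod int p ^ n"
  by (simp add: padic_ints_def)

lemma padic_carrier_iff:
  "x \<in> carrier (padic_ints p) \<longleftrightarrow>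
     (\<forall>n. 0 \<le> x n \<and> x n < int p ^ n \<and> x (Suc n) mod int p ^ n = x n)"
  by (simp add: padic_ints_def)

lemma padic_nth_mod:
  assumes "x \<in> carrier (padic_ints p)" "n \<le> k"
  shows "x k mod int p ^ n = x n"
  using assms(2)
proof (induction k rule: dec_induct)
  case base
  then show ?case using assms(1) by (simp add: padic_carrier_iff)
next
  case (step k)
  have "x (Suc k) mod int p ^ n = x (Suc k) mod int p ^ k mod int p ^ n"
    using step.hyps by (intro mod_mod_cancel[symmetric] le_imp_power_dvd) simp
  then show ?case using step.IH assms(1) by (simp add: padic_carrier_iff)
qed

context
  fixes p :: nat
  assumes p0: "0 < p"
begin

text \<open>The ring record has no explicit negation, so the difference \<open>z\<close> is
  recovered from \<open>z + y = x\<close>.\<close>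

lemma padic_diff_nth:
  assumes x: "x \<in> carrier (padic_ints p)" and y: "y \<in> carrier (padic_ints p)"
  shows "(x \<ominus>\<^bsub>padic_ints p\<^esub> y) n = (x n - y n) mod int p ^ n"
proof -
  interpret cring "padic_ints p" by (rule cring_padic_ints[OF p0])
  have add: "(a \<oplus>\<^bsub>padic_ints p\<^esub> b) n = (a n + b n) mod int p ^ n" for a b n
    by (simp add: padic_ints_def)
  let ?z = "x \<ominus>\<^bsub>padic_ints p\<^esub> y"
  have z: "?z \<in> carrier (padic_ints p)" using x y by simp
  have "?z \<oplus>\<^bsub>padic_ints p\<^esub> y = x" using x y by algebra
  then have "(?z n + y n) mod int p ^ n = x n" by (simp flip: add)
  then have "[?z n + y n = x n] (mod int p ^ n)"
    using padic_nth_mod[OF x, of n n] by (simp add: cong_def)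
  then have "[?z n = x n - y n] (mod int p ^ n)" by (simp add: cong_iff_dvd_diff algebra_simps)
  moreover have "?z n mod int p ^ n = ?z n" using padic_nth_mod[OF z] by simp
  ultimately show ?thesis by (simp add: cong_def)
qed

lemma padic_power_nth:
  assumes x: "x \<in> carrier (padic_ints p)"
  shows "(x [^]\<^bsub>padic_ints p\<^esub> (k :: nat)) n = x n ^ k mod int p ^ n"
proof -
  interpret cring "padic_ints p" by (rule cring_padic_ints[OF p0])
  show ?thesis
  proof (induction k)
    case 0
    then show ?case by (simp add: padic_ints_def)
  next
    case (Suc k)
    then show ?case by (simp add: padic_mult_nth mod_simps mult.commute)
  qed
qed

text \<open>Turns membership in the ideal generated by \<open>p ^ N\<close> into equality of single
  components.\<close>

lemma padic_cong_iff:
  assumes x: "x \<in> carrier (padic_ints p)" and y: "y \<in> carrier (padic_ints p)"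
  shows "padic_cong p N x y \<longleftrightarrow> x N = y N"
proof -
  interpret cring "padic_ints p" by (rule cring_padic_ints[OF p0])
  let ?z = "x \<ominus>\<^bsub>padic_ints p\<^esub> y"
  have z: "?z \<in> carrier (padic_ints p)" using x y by simp
  have zN: "?z N = 0 \<longleftrightarrow> x N = y N"
  proof -
    have "?z N = 0 \<longleftrightarrow> [x N = y N] (mod int p ^ N)"
      by (simp add: padic_diff_nth[OF x y] cong_iff_dvd_diff dvd_eq_mod_eq_0)
    then show ?thesis using padic_nth_mod[OF x, of N N] padic_nth_mod[OF y, of N N] by (simp add: cong_def)
  qed
  have "padic_cong p N x y \<longleftrightarrow>
      (\<exists>w\<in>carrier (padic_ints p). ?z = w \<otimes>\<^bsub>padic_ints p\<^esub> padic_of_int p (int p ^ N))"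
    by (auto simp: padic_cong_def cgenideal_def)
  also have "\<dots> \<longleftrightarrow> ?z N = 0"
  proof
    assume "\<exists>w\<in>carrier (padic_ints p). ?z = w \<otimes>\<^bsub>padic_ints p\<^esub> padic_of_int p (int p ^ N)"
    then obtain w where "?z = w \<otimes>\<^bsub>padic_ints p\<^esub> padic_of_int p (int p ^ N)" by blast
    then have "?z N = w N * (int p ^ N mod int p ^ N) mod int p ^ N"
      by (simp only: padic_mult_nth padic_of_int_def)
    then show "?z N = 0" by simp
  next
    assume z0: "?z N = 0"
    \<comment> \<open>Division by \<open>p ^ N\<close> loses \<open>N\<close> digits, so component
      \<open>n\<close> of the quotient is read off from component \<open>n + N\<close>.\<close>
    define w where "w = (\<lambda>n. ?z (n + N) div int p ^ N)"
    have dvd: "int p ^ N * w n = ?z (n + N)" for n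
    proof -
      have "?z (n + N) mod int p ^ N = 0" using padic_nth_mod[OF z, of N "n + N"] z0 by simp
      then show ?thesis by (simp add: w_def mod_eq_0_iff_dvd)
    qed
    have pos: "int p ^ N > 0" using p0 by simp
    have "w \<in> carrier (padic_ints p)"
      unfolding padic_carrier_iff
    proof (intro allI conjI)
      fix n
      have b: "0 \<le> ?z (n + N)" "?z (n + N) < int p ^ (n + N)" "?z (Suc n + N) mod int p ^ (n + N) = ?z (n + N)"
        using z by (auto simp: padic_carrier_iff)
      show "0 \<le> w n" using b pos by (simp add: w_def pos_imp_zdiv_nonneg_iff)
      have "int p ^ N * w n < int p ^ N * int p ^ n"
        using b(2) unfolding dvd by (simp add: power_add mult.commute)
      then show "w n < int p ^ n" using pos by simp
      have "int p ^ N * (w (Suc n) mod int p ^ n) = int p ^ N * w n"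
        using b(3) unfolding dvd[symmetric] by (simp add: power_add mult.commute[of "int p ^ n"] flip: mult_mod_right)
      then show "w (Suc n) mod int p ^ n = w n" using p0 by auto
    qed
    moreover have "?z = w \<otimes>\<^bsub>padic_ints p\<^esub> padic_of_int p (int p ^ N)"
    proof
      fix n
      have "(w \<otimes>\<^bsub>padic_ints p\<^esub> padic_of_int p (int p ^ N)) n = ?z (n + N) mod int p ^ n"
        by (simp add: padic_mult_nth padic_of_int_def mod_simps mult.commute[of "w n"] dvd)
      also have "\<dots> = ?z n" using padic_nth_mod[OF z, of n "n + N"] by simp
      finally show "?z n = (w \<otimes>\<^bsub>padic_ints p\<^esub> padic_of_int p (int p ^ N)) n" ..
    qed
    ultimately show "\<exists>w\<in>carrier (padic_ints p). ?z = w \<otimes>\<^bsub>padic_ints p\<^esub> padic_of_int p (int p ^ N)" by blast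
  qed
  finally show ?thesis using zN by simp
qed

end

text \<open>By continuity the limit exists, and its component \<open>N\<close> can be computed from
  any positive integer congruent to \<open>x\<close> modulo \<open>p ^ N\<close>.\<close>

lemma padic_Gamma_spec:
  assumes p: "prime p" and odd_p: "odd p" and x: "x \<in> carrier (padic_ints p)"
  shows "padic_Gamma p x \<in> carrier (padic_ints p)"
    and "\<And>n N. 0 < n \<Longrightarrow> [int n = x N] (mod int p ^ N) \<Longrightarrow>
           padic_Gamma p x N = padic_Gamma_nat p n mod int p ^ N"
proof -
  have p0: "0 < p" using p by (simp add: prime_gt_0_nat)
  have x_range: "0 \<le> x n" for n using x by (simp add: padic_carrier_iff)
  have lim_iff: "padic_tendsto p (\<lambda>i. padic_of_int p (f i)) y \<longleftrightarrow>
      (\<forall>N. \<exists>i0. \<forall>i\<ge>i0. f i mod int p ^ N = y N)"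
    if "y \<in> carrier (padic_ints p)" for f y
    unfolding padic_tendsto_def
    using padic_cong_iff[OF p0 padic_of_int_closed[OF p0] that] by (simp add: padic_of_int_def)
  \<comment> \<open>Integers approaching \<open>x\<close>; the summand \<open>p ^ i\<close> keeps
    them positive without changing the limit.\<close>
  define s where "s = (\<lambda>i. nat (x i) + p ^ i)"
  have s_pos: "0 < s i" for i using p0 by (simp add: s_def)
  have s_mod: "int (s i) mod int p ^ N = x N" if "N \<le> i" for i N
  proof -
    have "int p ^ N dvd int p ^ i" using that by (rule le_imp_power_dvd)
    then have "int (s i) mod int p ^ N = x i mod int p ^ N"
      using x_range by (auto simp: s_def elim!: dvdE)
    then show ?thesis using padic_nth_mod[OF x that] by simp
  qed
  define y where "y = (\<lambda>n. padic_Gamma_nat p (s n) mod int p ^ n)"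
  have y_eq: "padic_Gamma_nat p n mod int p ^ N = y N" if "0 < n" "int n mod int p ^ N = x N" for n N
    using padic_Gamma_nat_cong[OF p odd_p, of n "s N" N] that s_pos s_mod[of N N]
    by (simp add: y_def cong_def)
  have y: "y \<in> carrier (padic_ints p)"
    unfolding padic_carrier_iff
  proof (intro allI conjI)
    fix n
    have "y (Suc n) mod int p ^ n = padic_Gamma_nat p (s (Suc n)) mod int p ^ n"
      unfolding y_def by (intro mod_mod_cancel) simp
    then show "y (Suc n) mod int p ^ n = y n" using y_eq[OF s_pos s_mod[of n "Suc n"]] by simp
  qed (use p0 in \<open>auto simp: y_def\<close>)
  have "padic_Gamma p x = y"
    unfolding padic_Gamma_def
  proof (rule the_equality, intro conjI allI impI y)
    fix t assume "(\<forall>i. 0 < t i) \<and> padic_tendsto p (\<lambda>i. padic_of_int p (int (t i))) x"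
    then show "padic_tendsto p (\<lambda>i. padic_of_int p (padic_Gamma_nat p (t i))) y"
      unfolding lim_iff[OF x] lim_iff[OF y] using y_eq by blast
  next
    fix z
    assume z: "z \<in> carrier (padic_ints p) \<and> (\<forall>s. (\<forall>i. 0 < s i) \<and>
        padic_tendsto p (\<lambda>i. padic_of_int p (int (s i))) x \<longrightarrow>
        padic_tendsto p (\<lambda>i. padic_of_int p (padic_Gamma_nat p (s i))) z)"
    have "padic_tendsto p (\<lambda>i. padic_of_int p (int (s i))) x"
      unfolding lim_iff[OF x] using s_mod by blast
    then have "padic_tendsto p (\<lambda>i. padic_of_int p (padic_Gamma_nat p (s i))) z"
      using z s_pos by blast
    then have lim: "\<forall>N. \<exists>i0. \<forall>i\<ge>i0. padic_Gamma_nat p (s i) mod int p ^ N = z N"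
      unfolding lim_iff[OF conjunct1[OF z]] .
    \<comment> \<open>For uniqueness, any other candidate is tested on the sequence
      \<open>s\<close>, at an index beyond both \<open>N\<close> and \<open>i0\<close>.\<close>
    show "z = y"
    proof
      fix N
      obtain i0 where "\<forall>i\<ge>i0. padic_Gamma_nat p (s i) mod int p ^ N = z N" using lim by blast
      then show "z N = y N" using y_eq[OF s_pos s_mod[of N "max N i0"]] by simp
    qed
  qed
  then show "padic_Gamma p x \<in> carrier (padic_ints p)"
    "\<And>n N. 0 < n \<Longrightarrow> [int n = x N] (mod int p ^ N) \<Longrightarrow>
      padic_Gamma p x N = padic_Gamma_nat p n mod int p ^ N"
    using y y_eq padic_nth_mod[OF x] by (auto simp: cong_def)
qed

lemma padic_of_rat_spec:
  assumes p: "prime p" and b: "\<not> int p dvd b" and q: "q = of_int a / of_int b"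
  shows "padic_of_rat p q \<in> carrier (padic_ints p)"
    and "[b * padic_of_rat p q n = a] (mod int p ^ n)"
proof -
  have cancel: "[u = v] (mod int p ^ n)" if "[c * u = c * v] (mod int p ^ n)" "\<not> int p dvd c" for c u v n
    using cong_mult_lcancel[OF coprime_prime_power[OF p that(2)]] that(1) by blast
  have p0: "0 < p" using p by (simp add: prime_gt_0_nat)
  obtain a0 b0 where q0: "quotient_of q = (a0, b0)" by force
  then have q0': "q = of_int a0 / of_int b0" "coprime a0 b0" "b0 > 0"
    by (auto simp: quotient_of_div quotient_of_coprime quotient_of_denom_pos)
  have "b \<noteq> 0" using b by auto
  then have "(of_int (a * b0) :: rat) = of_int (a0 * b)"
    using q q0' by (simp add: field_simps)
  then have eq: "a * b0 = a0 * b" by (simp only: of_int_eq_iff)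
  have b0: "\<not> int p dvd b0"
  proof
    assume dvd: "int p dvd b0"
    then have "int p dvd a0 * b" by (simp flip: eq)
    then have "int p dvd a0" using p b by (simp add: prime_dvd_mult_iff)
    then have "int p dvd 1" using dvd q0'(2) by (metis coprime_common_divisor)
    then show False using p by simp
  qed
  let ?P = "\<lambda>x. x \<in> carrier (padic_ints p) \<and>
        padic_of_int p b0 \<otimes>\<^bsub>padic_ints p\<^esub> x = padic_of_int p a0"
  have P_iff: "?P x \<longleftrightarrow> x \<in> carrier (padic_ints p) \<and> (\<forall>n. [b0 * x n = a0] (mod int p ^ n))" for x
    by (auto simp: fun_eq_iff padic_mult_nth padic_of_int_def cong_def mod_simps)
  have "\<exists>c. [b0 * c = 1] (mod int p ^ n)" for n
    by (intro cong_solve_coprime_int coprime_prime_power p b0)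
  \<comment> \<open>\<open>c n\<close> inverts the reduced denominator modulo \<open>p ^ n\<close>,
    so \<open>a0 * c n\<close> is the only possible component.\<close>
  then obtain c where c: "[b0 * c n = 1] (mod int p ^ n)" for n by metis
  define x where "x = (\<lambda>n. a0 * c n mod int p ^ n)"
  have xa: "[b0 * x n = a0] (mod int p ^ n)" for n
  proof -
    have "[b0 * x n = a0 * (b0 * c n)] (mod int p ^ n)"
      by (simp add: x_def cong_def mod_simps mult_ac)
    also have "[a0 * (b0 * c n) = a0 * 1] (mod int p ^ n)"
      by (intro cong_scalar_left c)
    finally show ?thesis by simp
  qed
  have "?P x"
    unfolding P_iff unfolding padic_carrier_iff
  proof (intro conjI allI xa)
    fix n
    have "[b0 * x (Suc n) = a0] (mod int p ^ n)"
      using xa[of "Suc n"] by (rule cong_dvd_modulus) simp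
    then have "[b0 * x (Suc n) = b0 * x n] (mod int p ^ n)"
      using xa[of n] cong_sym cong_trans by blast
    from cancel[OF this b0] show "x (Suc n) mod int p ^ n = x n"
      by (simp add: cong_def) (simp add: x_def)
  qed (use p0 in \<open>auto simp: x_def\<close>)
  moreover have "z = x" if "?P z" for z
  proof
    fix n
    have "[b0 * z n = b0 * x n] (mod int p ^ n)"
      using that xa[of n] cong_sym cong_trans unfolding P_iff by blast
    from cancel[OF this b0] show "z n = x n"
      using padic_nth_mod[of z p n n] padic_nth_mod[of x p n n] that \<open>?P x\<close> by (simp add: cong_def)
  qed
  ultimately have "padic_of_rat p q = x"
    unfolding padic_of_rat_def q0 fst_conv snd_conv by (rule the_equality)
  with \<open>?P x\<close> show "padic_of_rat p q \<in> carrier (padic_ints p)" by blast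
  have "[b * (b0 * x n) = b * a0] (mod int p ^ n)" by (intro cong_scalar_left xa)
  then have "[b0 * (b * x n) = b0 * a] (mod int p ^ n)" using eq by (simp add: mult_ac)
  from cancel[OF this b0] show "[b * padic_of_rat p q n = a] (mod int p ^ n)"
    using \<open>padic_of_rat p q = x\<close> by simp
qed

text \<open>Clearing the denominators \<open>b\<close>, \<open>b'\<close> and \<open>f\<close> turns
  the rational congruence into an integer one, after which they cancel modulo
  \<open>p ^ N\<close>.\<close>

lemma padic_of_rat_mult_cong:
  assumes p: "prime p" and q: "p_integral p q" and c: "p_integral p c"
    and qc: "rat_pcong p N q (c * of_int z)"
  shows "padic_of_rat p q N = padic_of_rat p c N * z mod int p ^ N"
proof -
  obtain a b where ab: "\<not> int p dvd b" "q = of_int a / of_int b"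
    using q unfolding p_integral_def by blast
  obtain a' b' where ab': "\<not> int p dvd b'" "c = of_int a' / of_int b'"
    using c unfolding p_integral_def by blast
  obtain e f where ef: "\<not> int p dvd f" "q - c * of_int z = of_nat p ^ N * (of_int e / of_int f)"
    using qc unfolding rat_pcong_def p_integral_def by blast
  have nz: "b \<noteq> 0" "b' \<noteq> 0" "f \<noteq> 0" using ab ab' ef by auto
  have "(of_int ((a * b' - a' * b * z) * f) :: rat) = of_int (int p ^ N * (e * b * b'))"
    using ef(2) nz unfolding ab(2) ab'(2) by (simp add: field_simps)
  then have "int p ^ N dvd (a * b' - a' * b * z) * f" by (simp only: of_int_eq_iff dvd_triv_left)
  then have "int p ^ N dvd a * b' - a' * b * z"
    using coprime_prime_power[OF p ef(1)] coprime_dvd_mult_left_iff coprime_commute by blast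
  then have 1: "[a * b' = a' * b * z] (mod int p ^ N)" by (simp add: cong_iff_dvd_diff)
  let ?X = "padic_of_rat p q N" and ?Y = "padic_of_rat p c N"
  have "[b' * (b * ?X) = b' * a] (mod int p ^ N)"
    by (intro cong_scalar_left padic_of_rat_spec(2)[OF p ab])
  also have "b' * a = a * b'" by simp
  also note 1
  also have "a' * b * z = (b * z) * a'" by simp
  also have "[(b * z) * a' = (b * z) * (b' * ?Y)] (mod int p ^ N)"
    by (intro cong_scalar_left cong_sym[OF padic_of_rat_spec(2)[OF p ab']])
  finally have "[(b * b') * ?X = (b * b') * (?Y * z)] (mod int p ^ N)" by (simp add: mult_ac)
  moreover have "\<not> int p dvd b * b'" using p ab ab' by (simp add: prime_dvd_mult_iff)
  ultimately have "[?X = ?Y * z] (mod int p ^ N)"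
    using cong_mult_lcancel[OF coprime_prime_power[OF p]] by blast
  moreover have "?X mod int p ^ N = ?X"
    using padic_nth_mod[OF padic_of_rat_spec(1)[OF p ab]] by simp
  ultimately show ?thesis by (simp add: cong_def)
qed

text \<open>Bridge from the inverse limit back to the rationals: a positive integer \<open>s\<close>
  with \<open>d * s\<close> congruent to -1 replaces \<open>-1/d\<close> as argument.\<close>

lemma padic_cong_Gamma_power:
  assumes p: "prime p" and odd_p: "odd p" and q: "p_integral p q" and c: "p_integral p c"
    and s: "0 < s" "[int d * int s = - 1] (mod int p ^ N)" and d: "\<not> p dvd d"
    and qc: "rat_pcong p N q (c * of_int (padic_Gamma_nat p s ^ k))"
  shows "padic_cong p N (padic_of_rat p q)
           (padic_of_rat p c \<otimes>\<^bsub>padic_ints p\<^esub>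
             (padic_Gamma p (padic_of_rat p (- 1 / rat_of_nat d)) [^]\<^bsub>padic_ints p\<^esub> k))"
proof -
  have p0: "0 < p" using p by (simp add: prime_gt_0_nat)
  interpret cring "padic_ints p" by (rule cring_padic_ints[OF p0])
  let ?x = "padic_of_rat p (- 1 / rat_of_nat d)"
  have d': "\<not> int p dvd int d" using d by simp
  have "- 1 / rat_of_nat d = of_int (- 1) / of_int (int d)" by simp
  note x = padic_of_rat_spec[OF p d' this]
  have "[int d * int s = int d * ?x N] (mod int p ^ N)"
    using s(2) x(2) cong_sym cong_trans by blast
  then have "[int s = ?x N] (mod int p ^ N)"
    using cong_mult_lcancel[OF coprime_prime_power[OF p d']] by blast
  note G = padic_Gamma_spec(1)[OF p odd_p x(1)] padic_Gamma_spec(2)[OF p odd_p x(1) s(1) this]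
  have qcar: "padic_of_rat p q \<in> carrier (padic_ints p)" and ccar: "padic_of_rat p c \<in> carrier (padic_ints p)"
    using q c padic_of_rat_spec(1)[OF p] unfolding p_integral_def by blast+
  show ?thesis
    unfolding padic_cong_iff[OF p0 qcar m_closed[OF ccar nat_pow_closed[OF G(1)]]]
    unfolding padic_of_rat_mult_cong[OF p q c qc] padic_mult_nth padic_power_nth[OF p0 G(1)] G(2)
    by (simp add: mod_simps)
qed

section \<open>The two sums\<close>

context
  fixes p d m :: nat and i :: rat
  assumes p: "prime p" and odd_p: "odd p" and dm: "d * m = p + 1" and d3: "d \<ge> 3"
    and di: "rat_of_nat d * i = 1"
begin

private abbreviation (input) "P \<equiv> rat_of_nat p"
private abbreviation (input) "M \<equiv> rat_of_nat m"

lemmas pcong_trans [trans] = rat_pcong_trans[OF p]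

lemmas integral_rules = p_integral_add[OF p] p_integral_diff[OF p] p_integral_mult[OF p]
  p_integral_uminus[OF p] p_integral_power[OF p] p_integral_of_nat[OF p] p_integral_1[OF p]
  p_integral_of_int[OF p] p_integral_pochhammer[OF p] p_integral_fact[OF p]
  p_integral_neg_1[OF p] p_integral_2[OF p]

lemma prime_not_dvd_d: "\<not> p dvd d"
proof
  assume "p dvd d"
  then have "p dvd p + 1" using dm by (metis dvd_mult2)
  then have "p dvd 1" using dvd_add_right_iff[of p p 1] by simp
  then show False using p by simp
qed

lemma i_eq: "i = 1 / rat_of_nat d"
  using di d3 by (simp add: field_simps)

lemma p_integral_i: "p_integral p i"
  unfolding i_eq by (intro p_integral_divide[OF p] p_integral_1[OF p] p_unit_of_nat[OF p] prime_not_dvd_d)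

text \<open>This is \<open>d * m = p + 1\<close> divided by \<open>d\<close>. It writes
  \<open>i\<close>, which is \<open>1/d\<close>, as an integer plus a multiple of \<open>p\<close>,
  the form in which parameters can be moved.\<close>

lemma m_minus_p_i: "M - P * i = i"
proof -
  have "M = M * (rat_of_nat d * i)" using di by simp
  also have "\<dots> = rat_of_nat (d * m) * i" by simp
  also have "\<dots> = (P + 1) * i" unfolding dm by simp
  finally show ?thesis by (simp add: algebra_simps)
qed

lemma m_bounds: "0 < m" "2 * m < p" "3 * m \<le> p + 1"
proof -
  show "0 < m" using dm by (intro Nat.gr0I) simp
  show "3 * m \<le> p + 1" using mult_le_mono1[OF d3, of m] dm by simp
  then show "2 * m < p" using \<open>0 < m\<close> odd_prime_gt_2[OF p odd_p] by linarith
qed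

lemma p_unit_fact: "k < p \<Longrightarrow> p_unit p (fact k)"
  using p_unit_pochhammer_one[OF p p_integral_0[OF p], of k] by (simp add: pochhammer_fact)

section \<open>Moving the parameters modulo \<open>p ^ 2\<close>\<close>

lemma pochhammer_mult_power_prod:
  "pochhammer (a :: rat) k * pochhammer b k = (\<Prod>j<k. (a + of_nat j) * (b + of_nat j))"
  "pochhammer a k ^ n = (\<Prod>j<k. (a + of_nat j) ^ n)"
  by (simp_all add: pochhammer_prod prod.distrib prod_power_distrib atLeast0LessThan)

text \<open>With \<open>A = 1 + M + of_nat j\<close> every factor on the left is
  \<open>A - P * i\<close>. The shifts add up to \<open>- (d - 1) * P * i\<close>, which equals
  \<open>- P + P * i\<close>, the total on the right. The new parameter \<open>1 + M - P\<close> is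
  a negative integer and terminates the sum.\<close>

lemma rat_pcong_even_numerator:
  "rat_pcong p 2 (pochhammer (1 + i) k ^ (d - 1))
     (pochhammer (1 + M - P) k * pochhammer (1 + M + P * i) k * pochhammer (1 + M) k ^ (d - 3))"
proof -
  obtain e where e: "d = e + 3" using d3 by (metis add.commute le_Suc_ex)
  have ei: "(of_nat e + 3) * i = 1" using di e by simp
  have *: "rat_pcong p 2 ((A + P * (- i)) ^ (d - 1)) ((A - P) * (A + P * i) * A ^ (d - 3))"
    if A: "p_integral p A" for A
  proof -
    have "rat_pcong p 2 ((A + P * (- i)) ^ Suc (Suc e)) (A ^ Suc e * (A + of_nat (Suc (Suc e)) * (P * (- i))))"
      by (intro rat_pcong_power_linear[OF p] A integral_rules p_integral_i)
    also have "rat_pcong p 2 \<dots> ((A - P) * (A + P * i) * A ^ e)"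
    proof (rule rat_pcong_2I[OF p])
      \<comment> \<open>The linear term carries the factor \<open>1 - d * i\<close>, which is
        0.\<close>
      have "A ^ Suc e * (A + of_nat (Suc (Suc e)) * (P * (- i))) - (A - P) * (A + P * i) * A ^ e
        = A ^ e * (A * P * (1 - (of_nat e + 3) * i) + P ^ 2 * i)"
        by (simp add: algebra_simps power2_eq_square)
      then show "A ^ Suc e * (A + of_nat (Suc (Suc e)) * (P * (- i))) - (A - P) * (A + P * i) * A ^ e
        = P ^ 2 * (A ^ e * i)"
        by (simp add: ei)
    qed (intro integral_rules A p_integral_i)
    finally show ?thesis by (simp add: e)
  qed
  have "rat_pcong p 2 (\<Prod>j<k. (1 + i + of_nat j) ^ (d - 1))
      (\<Prod>j<k. (1 + M - P + of_nat j) * (1 + M + P * i + of_nat j) * (1 + M + of_nat j) ^ (d - 3))"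
  proof (rule rat_pcong_prod[OF p], intro conjI)
    fix j
    have "rat_pcong p 2 ((1 + M + of_nat j + P * (- i)) ^ (d - 1))
      ((1 + M + of_nat j - P) * (1 + M + of_nat j + P * i) * (1 + M + of_nat j) ^ (d - 3))"
      by (intro * integral_rules)
    moreover have "1 + M + of_nat j + P * (- i) = 1 + i + of_nat j" using m_minus_p_i by simp
    ultimately show "rat_pcong p 2 ((1 + i + of_nat j) ^ (d - 1))
      ((1 + M - P + of_nat j) * (1 + M + P * i + of_nat j) * (1 + M + of_nat j) ^ (d - 3))"
      by (simp add: algebra_simps)
  qed (intro integral_rules p_integral_i)+
  then show ?thesis by (simp only: pochhammer_prod prod_power_distrib prod.distrib atLeast0LessThan)
qed

text \<open>The opposite shifts cancel to first order. They put the denominator parameters at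
  integer distance from \<open>i - 1\<close> and \<open>1 + M + P * i\<close>.\<close>

lemma rat_pcong_even_denominator:
  "rat_pcong p 2 (fact k ^ 2) (pochhammer (1 - P * i) k * pochhammer (1 + P * i) k)"
proof -
  have "rat_pcong p 2 (\<Prod>j<k. (1 + of_nat j) ^ 2) (\<Prod>j<k. (1 - P * i + of_nat j) * (1 + P * i + of_nat j))"
  proof (rule rat_pcong_prod[OF p], intro conjI)
    fix j
    show "rat_pcong p 2 ((1 + of_nat j) ^ 2) ((1 - P * i + of_nat j) * (1 + P * i + of_nat j))"
      by (rule rat_pcong_2I[OF p, where e = "i ^ 2"])
         (simp add: algebra_simps power2_eq_square, intro integral_rules p_integral_i)
  qed (intro integral_rules p_integral_i)+
  then show ?thesis
    by (simp only: pochhammer_fact pochhammer_mult_power_prod)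
qed

text \<open>The two new factors lie symmetrically about \<open>M - P * i + of_nat j\<close>, at
  distance \<open>P * (1 - i)\<close>; the error is the square of that distance.\<close>

lemma rat_pcong_odd_numerator:
  "rat_pcong p 2 (pochhammer i k ^ 2) (pochhammer (M - P) k * pochhammer (M + P - 2 * P * i) k)"
proof -
  have "rat_pcong p 2 (\<Prod>j<k. (i + of_nat j) ^ 2) (\<Prod>j<k. (M - P + of_nat j) * (M + P - 2 * P * i + of_nat j))"
  proof (rule rat_pcong_prod[OF p], intro conjI)
    fix j
    have "rat_pcong p 2 ((M - P * i + of_nat j) ^ 2) ((M - P + of_nat j) * (M + P - 2 * P * i + of_nat j))"
      by (rule rat_pcong_2I[OF p, where e = "(1 - i) ^ 2"])
         (simp add: algebra_simps power2_eq_square, intro integral_rules p_integral_i)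
    then show "rat_pcong p 2 ((i + of_nat j) ^ 2) ((M - P + of_nat j) * (M + P - 2 * P * i + of_nat j))"
      by (simp only: m_minus_p_i)
  qed (intro integral_rules p_integral_i)+
  then show ?thesis by (simp only: pochhammer_mult_power_prod)
qed

text \<open>The shifts sum to \<open>P * (1 - 2 * i - (d - 2) * i) = 0\<close>. They are chosen so
  that the numerator parameters \<open>M + P - 2 * P * i\<close> and \<open>1 + i\<close> exceed the
  new denominator parameters by integers.\<close>

lemma rat_pcong_odd_denominator:
  "rat_pcong p 2 (fact k ^ (d - 1))
     (pochhammer (1 + P * (1 - 2 * i)) k * pochhammer (1 - P * i) k ^ (d - 2))"
proof -
  obtain e where e: "d = e + 3" using d3 by (metis add.commute le_Suc_ex)
  have ei: "of_nat e * i = 1 - 3 * i" using di e by (simp add: algebra_simps)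
  note I = integral_rules p_integral_i
  have *: "rat_pcong p 2 (A ^ (d - 1)) ((A + P * (1 - 2 * i)) * (A + P * (- i)) ^ (d - 2))"
    if A: "p_integral p A" for A
  proof -
    have "rat_pcong p 2 ((A + P * (1 - 2 * i)) * (A + P * (- i)) ^ Suc e)
        ((A + P * (1 - 2 * i)) * (A ^ e * (A + of_nat (Suc e) * (P * (- i)))))"
      by (intro rat_pcong_scale[OF p] rat_pcong_power_linear[OF p] A I)
    also have "rat_pcong p 2 \<dots> (A ^ (e + 2))"
    proof (rule rat_pcong_2I[OF p])
      have "of_nat (Suc e) * (P * (- i)) = - P * (of_nat e * i + i)"
        by (simp add: algebra_simps)
      also have "\<dots> = - P * (1 - 2 * i)" unfolding ei by simp
      finally have l: "of_nat (Suc e) * (P * (- i)) = - P * (1 - 2 * i)" .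
      show "(A + P * (1 - 2 * i)) * (A ^ e * (A + of_nat (Suc e) * (P * (- i)))) - A ^ (e + 2)
        = P ^ 2 * (- (A ^ e * (1 - 2 * i) ^ 2))"
        unfolding l by (simp add: algebra_simps power2_eq_square)
    qed (intro A I)
    finally show ?thesis using rat_pcong_sym[OF p] by (simp add: e)
  qed
  have "rat_pcong p 2 (\<Prod>j<k. (1 + of_nat j) ^ (d - 1))
     (\<Prod>j<k. (1 + P * (1 - 2 * i) + of_nat j) * (1 - P * i + of_nat j) ^ (d - 2))"
  proof (rule rat_pcong_prod[OF p], intro conjI)
    fix j
    have "rat_pcong p 2 ((1 + of_nat j) ^ (d - 1))
      ((1 + of_nat j + P * (1 - 2 * i)) * (1 + of_nat j + P * (- i)) ^ (d - 2))"
      by (intro * I)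
    then show "rat_pcong p 2 ((1 + of_nat j) ^ (d - 1))
      ((1 + P * (1 - 2 * i) + of_nat j) * (1 - P * i + of_nat j) ^ (d - 2))"
      by (simp add: algebra_simps)
  qed (intro I)+
  then show ?thesis
    by (simp only: pochhammer_fact pochhammer_prod prod_power_distrib prod.distrib atLeast0LessThan)
qed

lemma p_unit_pochhammers:
  assumes "k < p"
  shows "p_unit p (pochhammer (1 - P * i) k)" "p_unit p (pochhammer (1 + P * i) k)"
    "p_unit p (pochhammer (1 + P * (1 - 2 * i)) k)"
proof -
  note I = integral_rules p_integral_i
  have "p_unit p (pochhammer (1 + P * (- i)) k)"
    by (intro p_unit_pochhammer_one[OF p] assms I)
  then show "p_unit p (pochhammer (1 - P * i) k)" by simp
  show "p_unit p (pochhammer (1 + P * i) k)" "p_unit p (pochhammer (1 + P * (1 - 2 * i)) k)"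
    by (intro p_unit_pochhammer_one[OF p] assms I)+
qed

lemmas pochhammers_nonzero = p_unit_pochhammers[THEN p_unit_nonzero[OF p]]

lemma rat_pcong_Gamma_power:
  "rat_pcong p 2 (of_int (padic_Gamma_nat p ((p - 1) * m) ^ d))
     (- ((- 1) ^ m * fact (p - 1 - m)) / fact m ^ (d - 1))"
proof -
  let ?G = "padic_Gamma_nat p ((p - 1) * m)"
  have u: "p_unit p (fact m ^ (d - 1))"
    using m_bounds by (intro p_unit_power[OF p] p_unit_fact) simp
  have "d > 1" using d3 by simp
  from rat_pcong_of_int[OF p padic_Gamma_nat_power_cong[OF p odd_p dm this]]
  have "rat_pcong p 2 (of_int (?G ^ d) * fact m ^ (d - 1) * (- 1) ^ m) (- fact (p - 1 - m))"
    by simp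
  from rat_pcong_scale(2)[OF p _ this, of "(- 1) ^ m"]
  have "rat_pcong p 2 (of_int (?G ^ d) * fact m ^ (d - 1) * (- 1) ^ m * (- 1) ^ m) (- fact (p - 1 - m) * (- 1) ^ m)"
    by (simp only: integral_rules)
  then have "rat_pcong p 2 (of_int (?G ^ d) * fact m ^ (d - 1)) (- ((- 1) ^ m * fact (p - 1 - m)))"
    by (simp add: mult.assoc mult.commute)
  then have "rat_pcong p 2 (of_int (?G ^ d) * fact m ^ (d - 1) / fact m ^ (d - 1))
     (- ((- 1) ^ m * fact (p - 1 - m)) / fact m ^ (d - 1))"
    by (intro rat_pcong_divide[OF p] rat_pcong_refl[OF p] u integral_rules)
  then show ?thesis by simp
qed

section \<open>Integrality and evaluation of the two sums\<close>

lemma even_case_sum_p_integral: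
  "p_integral p (\<Sum>k=0..p - 1. pochhammer (i - 1) k * pochhammer (1 + i) k ^ (d - 1) / fact k ^ d)"
  using odd_prime_gt_0[OF p odd_p]
  by (intro p_integral_sum[OF p] p_integral_divide[OF p] p_unit_power[OF p] p_unit_fact integral_rules p_integral_i) auto

lemma odd_case_sum_p_integral:
  "p_integral p (\<Sum>k=0..p - 1. pochhammer i k ^ 2 * pochhammer (1 + i) k ^ (d - 2) / fact k ^ d)"
  using odd_prime_gt_0[OF p odd_p]
  by (intro p_integral_sum[OF p] p_integral_divide[OF p] p_unit_power[OF p] p_unit_fact integral_rules p_integral_i) auto

text \<open>The excesses are \<open>m - 2\<close>, \<open>m\<close>, and \<open>m\<close> with
  multiplicity \<open>d - 3\<close>, in total \<open>p - 1 - m\<close>. The first has to be a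
  natural number, whence \<open>m2\<close>; the parameter \<open>i - 1\<close> itself is not
  moved.\<close>

lemma even_case_sum_rat_pcong:
  assumes m2: "m \<ge> 2"
  shows "rat_pcong p 2 (\<Sum>k=0..p - 1. pochhammer (i - 1) k * pochhammer (1 + i) k ^ (d - 1) / fact k ^ d)
           ((i - i ^ 2) * of_int (padic_Gamma_nat p ((p - 1) * m) ^ d))"
proof -
  note I = integral_rules p_integral_i
  define N where "N = p - 1 - m"
  have mp: "m < p" using m_bounds by simp
  have Nrat: "- of_nat N = 1 + M - P" using m_bounds odd_prime_gt_0[OF p odd_p] by (simp add: N_def of_nat_diff)
  have Nsum: "N = (m - 2) + m + (d - 3) * m"
    using dm d3 m2 m_bounds unfolding N_def by (simp add: diff_mult_distrib)
  have b1: "1 - P * i + of_nat (m - 2) = i - 1" using m_minus_p_i m2 by (simp add: of_nat_diff)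
  let ?T = "\<lambda>k. pochhammer (- of_nat N) k * pochhammer (1 - P * i + of_nat (m - 2)) k
              * pochhammer (1 + P * i + of_nat m) k * pochhammer (1 + of_nat m) k ^ (d - 3)
            / (fact k * pochhammer (1 - P * i) k * pochhammer (1 + P * i) k * pochhammer 1 k ^ (d - 3))"
  let ?R = "(- 1) ^ N * fact N / (pochhammer (1 - P * i) (m - 2) * pochhammer (1 + P * i) m * pochhammer 1 m ^ (d - 3))"
  have fd: "(x :: rat) ^ d = x * x ^ 2 * x ^ (d - 3)" "x ^ (d - 1) = x ^ 2 * x ^ (d - 3)" for x
  proof -
    obtain e where "d = e + 3" using d3 by (metis add.commute le_Suc_ex)
    then show "x ^ d = x * x ^ 2 * x ^ (d - 3)" "x ^ (d - 1) = x ^ 2 * x ^ (d - 3)"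
      by (simp_all add: eval_nat_numeral)
  qed
  have "rat_pcong p 2 (\<Sum>k=0..p - 1. pochhammer (i - 1) k * pochhammer (1 + i) k ^ (d - 1) / fact k ^ d)
      (\<Sum>k=0..p - 1. ?T k)"
  proof (rule rat_pcong_sum[OF p])
    fix k assume "k \<in> {0..p - 1}"
    then have k: "k < p" using odd_prime_gt_0[OF p odd_p] by simp
    have "rat_pcong p 2 (pochhammer (i - 1) k * pochhammer (1 + i) k ^ (d - 1) / (fact k * fact k ^ 2 * fact k ^ (d - 3)))
      (pochhammer (i - 1) k * (pochhammer (1 + M - P) k * pochhammer (1 + M + P * i) k * pochhammer (1 + M) k ^ (d - 3))
       / (fact k * (pochhammer (1 - P * i) k * pochhammer (1 + P * i) k) * fact k ^ (d - 3)))"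
      by (intro rat_pcong_divide[OF p] rat_pcong_scale[OF p] rat_pcong_even_numerator rat_pcong_even_denominator
          p_unit_mult[OF p] p_unit_power[OF p] p_unit_pochhammers p_unit_fact k I)
    then show "rat_pcong p 2 (pochhammer (i - 1) k * pochhammer (1 + i) k ^ (d - 1) / fact k ^ d) (?T k)"
      unfolding fd(1) Nrat b1 pochhammer_fact[symmetric] by (simp only: mult_ac add_ac)
  qed
  also have "(\<Sum>k=0..p - 1. ?T k) = ?R"
  proof (rule karlsson_minton_three[OF Nsum])
    show "pochhammer (1 - P * i) k \<noteq> 0 \<and> pochhammer (1 + P * i) k \<noteq> 0 \<and> pochhammer (1 :: rat) k \<noteq> 0"
      if "k \<le> p - 1" for k
    proof -
      have "k < p" using that odd_prime_gt_0[OF p odd_p] by simp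
      then show ?thesis using pochhammers_nonzero by (simp flip: pochhammer_fact)
    qed
  qed (use m_bounds in \<open>auto simp: N_def\<close>)
  \<comment> \<open>Completing \<open>pochhammer (1 - P * i) (m - 2)\<close> to length
    \<open>m\<close> adds the factors \<open>i - 1\<close> and \<open>i\<close>, and their product
    is \<open>- (i - i ^ 2)\<close>. Then the moved denominators can be folded back into
    \<open>fact m ^ 2\<close>.\<close>
  also have "?R = - (i - i ^ 2) * ((- 1) ^ m * fact N)
      / (pochhammer (1 - P * i) m * pochhammer (1 + P * i) m * fact m ^ (d - 3))"
  proof -
    obtain m' where m': "m = Suc (Suc m')" using m2 by (metis One_nat_def Suc_1 Suc_le_D Suc_le_mono)
    have "pochhammer (1 - P * i) m = pochhammer (1 - P * i) (m - 2) * (i - 1) * i"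
      using b1 unfolding m' by (simp add: pochhammer_Suc)
    moreover have "i \<noteq> 0" "i - 1 \<noteq> 0" using d3 by (auto simp: i_eq)
    moreover have "pochhammer (1 - P * i) (m - 2) \<noteq> 0" "pochhammer (1 + P * i) m \<noteq> 0"
      using mp by (intro pochhammers_nonzero; simp)+
    moreover have "even (p - 1)" using odd_p by simp
    then have "(- 1 :: rat) ^ N = (- 1) ^ m"
      using m_bounds odd_p unfolding N_def by (auto simp: minus_one_power_iff)
    ultimately show ?thesis
      by (simp add: pochhammer_fact[symmetric] divide_simps) (simp add: algebra_simps power2_eq_square)
  qed
  also have "rat_pcong p 2 \<dots> (- (i - i ^ 2) * ((- 1) ^ m * fact N) / (fact m ^ 2 * fact m ^ (d - 3)))"
    by (intro rat_pcong_divide[OF p] rat_pcong_refl[OF p] rat_pcong_scale(2)[OF p]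
          rat_pcong_sym[OF p rat_pcong_even_denominator] p_unit_mult[OF p] p_unit_power[OF p]
          p_unit_pochhammers p_unit_fact mp I)
  also have "- (i - i ^ 2) * ((- 1) ^ m * fact N) / (fact m ^ 2 * fact m ^ (d - 3))
     = (i - i ^ 2) * (- ((- 1) ^ m * fact (p - 1 - m)) / fact m ^ (d - 1))"
    by (simp only: fd(2) N_def mult_minus_left mult_minus_right times_divide_eq_right)
  also have "rat_pcong p 2 \<dots> ((i - i ^ 2) * of_int (padic_Gamma_nat p ((p - 1) * m) ^ d))"
    by (intro rat_pcong_scale[OF p] rat_pcong_sym[OF p rat_pcong_Gamma_power] I)
  finally show ?thesis .
qed

text \<open>Here the excesses are \<open>m - 1\<close>, \<open>m\<close>, and \<open>m\<close> with
  multiplicity \<open>d - 3\<close>, in total \<open>p - m\<close>.\<close>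

lemma odd_case_sum_rat_pcong:
  "rat_pcong p 2 (\<Sum>k=0..p - 1. pochhammer i k ^ 2 * pochhammer (1 + i) k ^ (d - 2) / fact k ^ d)
           (- (i ^ 2) * of_int (padic_Gamma_nat p ((p - 1) * m) ^ d))"
proof -
  note I = integral_rules p_integral_i
  define N where "N = p - m"
  define b where "b = 1 + P * (1 - 2 * i)"
  have Nrat: "- of_nat N = M - P" using m_bounds by (simp add: N_def of_nat_diff)
  have Nsum: "N = (m - 1) + m + (d - 3) * m"
    using dm d3 m_bounds unfolding N_def by (simp add: diff_mult_distrib)
  have b1: "b + of_nat (m - 1) = M + P - 2 * P * i"
    using m_bounds by (simp add: b_def of_nat_diff algebra_simps)
  have b2: "1 - P * i + of_nat m = 1 + i" using m_minus_p_i by simp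
  \<comment> \<open>The parameter \<open>1 - P * i\<close> of multiplicity \<open>d - 2\<close> is
    split as one plus \<open>d - 3\<close> to fit \<open>karlsson_minton_three\<close>.\<close>
  let ?T = "\<lambda>k. pochhammer (- of_nat N) k * pochhammer (b + of_nat (m - 1)) k
              * pochhammer (1 - P * i + of_nat m) k * pochhammer (1 - P * i + of_nat m) k ^ (d - 3)
            / (fact k * pochhammer b k * pochhammer (1 - P * i) k * pochhammer (1 - P * i) k ^ (d - 3))"
  let ?R = "(- 1) ^ N * fact N / (pochhammer b (m - 1) * pochhammer (1 - P * i) m * pochhammer (1 - P * i) m ^ (d - 3))"
  have fd: "(x :: rat) ^ d = x * x ^ (d - 1)" "x ^ (d - 2) = x * x ^ (d - 3)" for x
  proof -
    obtain e where "d = e + 3" using d3 by (metis add.commute le_Suc_ex)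
    then show "x ^ d = x * x ^ (d - 1)" "x ^ (d - 2) = x * x ^ (d - 3)"
      by (simp_all add: eval_nat_numeral)
  qed
  have "rat_pcong p 2 (\<Sum>k=0..p - 1. pochhammer i k ^ 2 * pochhammer (1 + i) k ^ (d - 2) / fact k ^ d)
      (\<Sum>k=0..p - 1. ?T k)"
  proof (rule rat_pcong_sum[OF p])
    fix k assume "k \<in> {0..p - 1}"
    then have k: "k < p" using odd_prime_gt_0[OF p odd_p] by simp
    have "rat_pcong p 2 (pochhammer i k ^ 2 * pochhammer (1 + i) k ^ (d - 2) / (fact k * fact k ^ (d - 1)))
      (pochhammer (M - P) k * pochhammer (M + P - 2 * P * i) k * pochhammer (1 + i) k ^ (d - 2)
       / (fact k * (pochhammer b k * pochhammer (1 - P * i) k ^ (d - 2))))"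
      unfolding b_def
      by (intro rat_pcong_divide[OF p] rat_pcong_scale[OF p] rat_pcong_odd_numerator rat_pcong_odd_denominator
          p_unit_mult[OF p] p_unit_power[OF p] p_unit_pochhammers p_unit_fact k I)
    then show "rat_pcong p 2 (pochhammer i k ^ 2 * pochhammer (1 + i) k ^ (d - 2) / fact k ^ d) (?T k)"
      unfolding fd Nrat b1 b2 by (simp only: mult_ac)
  qed
  also have "(\<Sum>k=0..p - 1. ?T k) = ?R"
  proof (rule karlsson_minton_three[OF Nsum])
    show "pochhammer b k \<noteq> 0 \<and> pochhammer (1 - P * i) k \<noteq> 0 \<and> pochhammer (1 - P * i) k \<noteq> 0"
      if "k \<le> p - 1" for k
    proof -
      have "k < p" using that odd_prime_gt_0[OF p odd_p] by simp
      then show ?thesis using pochhammers_nonzero by (simp add: b_def)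
    qed
  qed (use m_bounds in \<open>auto simp: N_def\<close>)
  \<comment> \<open>One factor is drawn from \<open>fact N\<close> and one is added to complete
    \<open>pochhammer b m\<close>; their product is again of the moved numerator form.\<close>
  also have "?R = ((- 1) ^ m * fact (p - 1 - m)) * ((M - P) * (M + P - 2 * P * i))
      / (pochhammer b m * pochhammer (1 - P * i) m ^ (d - 2))"
  proof -
    obtain m' where m': "m = Suc m'" using m_bounds by (metis Suc_pred)
    have bm: "pochhammer b m = pochhammer b (m - 1) * (M + P - 2 * P * i)"
      using b1 unfolding m' by (simp add: pochhammer_Suc)
    have nz: "pochhammer b m \<noteq> 0" "pochhammer (1 - P * i) m \<noteq> 0"
      using m_bounds unfolding b_def by (intro pochhammers_nonzero; simp)+
    have sgn: "(- 1 :: rat) ^ N = - ((- 1) ^ m)"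
      using m_bounds odd_p unfolding N_def by (auto simp: minus_one_power_iff)
    have fN: "fact N = (P - M) * fact (p - 1 - m)"
    proof -
      have "fact N = rat_of_nat N * fact (N - 1)" using m_bounds by (intro fact_reduce) (simp add: N_def)
      then show ?thesis using m_bounds by (simp add: N_def of_nat_diff)
    qed
    have num: "(- 1) ^ N * fact N = (- 1) ^ m * fact (p - 1 - m) * (M - P)"
      unfolding sgn fN by (simp add: algebra_simps)
    show ?thesis
      unfolding num fd(2) using nz unfolding bm by (simp add: divide_simps)
  qed
  also have "rat_pcong p 2 \<dots> (((- 1) ^ m * fact (p - 1 - m)) * i ^ 2 / fact m ^ (d - 1))"
  proof (rule rat_pcong_divide[OF p])
    \<comment> \<open>The numerator congruence for Pochhammer symbols of length 1.\<close>
    have "rat_pcong p 2 ((M - P) * (M + P - 2 * P * i)) (i ^ 2)"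
      using rat_pcong_sym[OF p rat_pcong_odd_numerator[of 1]] by simp
    then show "rat_pcong p 2 ((- 1) ^ m * fact (p - 1 - m) * ((M - P) * (M + P - 2 * P * i)))
      ((- 1) ^ m * fact (p - 1 - m) * i ^ 2)"
      by (intro rat_pcong_scale(1)[OF p] I)
    show "rat_pcong p 2 (pochhammer b m * pochhammer (1 - P * i) m ^ (d - 2)) (fact m ^ (d - 1))"
      unfolding b_def by (rule rat_pcong_sym[OF p rat_pcong_odd_denominator])
    show "p_unit p (pochhammer b m * pochhammer (1 - P * i) m ^ (d - 2))" "p_unit p (fact m ^ (d - 1))"
      unfolding b_def using m_bounds
      by (auto intro!: p_unit_mult[OF p] p_unit_power[OF p] p_unit_pochhammers p_unit_fact)
    show "p_integral p ((- 1) ^ m * fact (p - 1 - m) * i ^ 2)"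
      by (intro I)
  qed
  also have "((- 1) ^ m * fact (p - 1 - m)) * i ^ 2 / fact m ^ (d - 1)
     = - (i ^ 2) * (- ((- 1) ^ m * fact (p - 1 - m)) / fact m ^ (d - 1))"
    by simp
  also have "rat_pcong p 2 \<dots> (- (i ^ 2) * of_int (padic_Gamma_nat p ((p - 1) * m) ^ d))"
    by (intro rat_pcong_scale[OF p] rat_pcong_sym[OF p rat_pcong_Gamma_power] I)
  finally show ?thesis .
qed

text \<open>Since \<open>d * m = p + 1\<close>, the product is
  \<open>(p - 1) * (p + 1) = p ^ 2 - 1\<close>.\<close>

lemma Gamma_argument: "0 < (p - 1) * m" "[int d * int ((p - 1) * m) = - 1] (mod int p ^ 2)"
proof -
  show "0 < (p - 1) * m" using odd_prime_gt_2[OF p odd_p] m_bounds by simp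
  have "int d * int ((p - 1) * m) = (int p - 1) * int (d * m)"
    using odd_prime_gt_0[OF p odd_p] by (simp add: of_nat_diff)
  then show "[int d * int ((p - 1) * m) = - 1] (mod int p ^ 2)"
    unfolding dm by (simp add: cong_iff_dvd_diff algebra_simps power2_eq_square)
qed

end

lemma cong_minus_one_obtain:
  assumes "[int p = - 1] (mod int d)"
  obtains m where "d * m = p + 1"
proof -
  have "int d dvd int (p + 1)" using assms by (simp add: cong_iff_dvd_diff add.commute)
  then have "d dvd p + 1" by (simp only: int_dvd_int_iff)
  then show ?thesis using that by (metis dvdE)
qed

theorem theorem1p1:
  shows "(\<forall>(d::nat) (p::nat).
            d \<ge> 4 \<and> even d \<and> prime p \<and> [int p = - 1] (mod int d) \<and> p \<ge> 2 * d - 1 \<longrightarrow>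
            padic_cong p 2
              (padic_of_rat p
                (\<Sum>k = 0..p - 1.
                   pochhammer (1 / rat_of_nat d - 1) k * pochhammer (1 + 1 / rat_of_nat d) k ^ (d - 1)
                     / fact k ^ d))
              (padic_of_rat p ((rat_of_nat d - 1) / rat_of_nat d ^ 2) \<otimes>\<^bsub>padic_ints p\<^esub>
                 (padic_Gamma p (padic_of_rat p (- 1 / rat_of_nat d)) [^]\<^bsub>padic_ints p\<^esub> d)))
       \<and> (\<forall>(d::nat) (p::nat).
            d \<ge> 3 \<and> odd d \<and> prime p \<and> odd p \<and> [int p = - 1] (mod int d) \<longrightarrow>
            padic_cong p 2
              (padic_of_rat p
                (\<Sum>k = 0..p - 1.
                   pochhammer (1 / rat_of_nat d) k ^ 2 * pochhammer (1 + 1 / rat_of_nat d) k ^ (d - 2)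
                     / fact k ^ d))
              (padic_of_rat p (- 1 / rat_of_nat d ^ 2) \<otimes>\<^bsub>padic_ints p\<^esub>
                 (padic_Gamma p (padic_of_rat p (- 1 / rat_of_nat d)) [^]\<^bsub>padic_ints p\<^esub> d)))"
proof (intro conjI allI impI)
  fix d p :: nat
  assume A: "d \<ge> 4 \<and> even d \<and> prime p \<and> [int p = - 1] (mod int d) \<and> p \<ge> 2 * d - 1"
  then have p: "prime p" and d3: "d \<ge> 3" by auto
  obtain m where dm: "d * m = p + 1" using A cong_minus_one_obtain by blast
  \<comment> \<open>Oddness of \<open>p\<close> comes from the bound: \<open>2 * d - 1\<close> is at
    least 7.\<close>
  have "p \<noteq> 2" using A by auto
  then have odd_p: "odd p" using p primes_dvd_imp_eq two_is_prime_nat by blast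
  \<comment> \<open>The bound on \<open>p\<close> says that \<open>d * m = p + 1\<close> is at least
    \<open>2 * d\<close>.\<close>
  have m2: "m \<ge> 2"
  proof (rule ccontr)
    assume "\<not> m \<ge> 2"
    then have "d * m \<le> d * 1" by (intro mult_le_mono2) simp
    moreover have "4 \<le> d" "2 * d - 1 \<le> p" using A by auto
    ultimately show False using dm by linarith
  qed
  let ?i = "1 / rat_of_nat d"
  have di: "rat_of_nat d * ?i = 1" using d3 by simp
  note ctxt = p odd_p dm d3 di
  have i: "p_integral p ?i" by (rule p_integral_i[OF ctxt])
  have c: "(rat_of_nat d - 1) / rat_of_nat d ^ 2 = ?i - ?i ^ 2"
    using d3 by (simp add: field_simps power2_eq_square)
  show "padic_cong p 2
              (padic_of_rat p
                (\<Sum>k = 0..p - 1.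
                   pochhammer (1 / rat_of_nat d - 1) k * pochhammer (1 + 1 / rat_of_nat d) k ^ (d - 1)
                     / fact k ^ d))
              (padic_of_rat p ((rat_of_nat d - 1) / rat_of_nat d ^ 2) \<otimes>\<^bsub>padic_ints p\<^esub>
                 (padic_Gamma p (padic_of_rat p (- 1 / rat_of_nat d)) [^]\<^bsub>padic_ints p\<^esub> d))"
    unfolding c
    by (rule padic_cong_Gamma_power[OF p odd_p even_case_sum_p_integral[OF ctxt] _ Gamma_argument[OF ctxt]
          prime_not_dvd_d[OF ctxt] even_case_sum_rat_pcong[OF ctxt m2]])
       (intro p_integral_diff[OF p] p_integral_power[OF p] i)
next
  fix d p :: nat
  assume A: "d \<ge> 3 \<and> odd d \<and> prime p \<and> odd p \<and> [int p = - 1] (mod int d)"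
  then have p: "prime p" and d3: "d \<ge> 3" and odd_p: "odd p" by auto
  obtain m where dm: "d * m = p + 1" using A cong_minus_one_obtain by blast
  let ?i = "1 / rat_of_nat d"
  have di: "rat_of_nat d * ?i = 1" using d3 by simp
  note ctxt = p odd_p dm d3 di
  have i: "p_integral p ?i" by (rule p_integral_i[OF ctxt])
  have c: "- 1 / rat_of_nat d ^ 2 = - (?i ^ 2)" by (simp add: power_divide)
  show "padic_cong p 2
              (padic_of_rat p
                (\<Sum>k = 0..p - 1.
                   pochhammer (1 / rat_of_nat d) k ^ 2 * pochhammer (1 + 1 / rat_of_nat d) k ^ (d - 2)
                     / fact k ^ d))
              (padic_of_rat p (- 1 / rat_of_nat d ^ 2) \<otimes>\<^bsub>padic_ints p\<^esub>
                 (padic_Gamma p (padic_of_rat p (- 1 / rat_of_nat d)) [^]\<^bsub>padic_ints p\<^esub> d))"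
    unfolding c
    by (rule padic_cong_Gamma_power[OF p odd_p odd_case_sum_p_integral[OF ctxt] _ Gamma_argument[OF ctxt]
          prime_not_dvd_d[OF ctxt] odd_case_sum_rat_pcong[OF ctxt]])
       (intro p_integral_uminus[OF p] p_integral_power[OF p] i)
qed

end
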